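(* Let $\Gamma$ be a countable discrete group and $p\in[1,2)$. Then $$\mathbf S_p(\Gamma)=\{M_{\Phi(f)}: f\in\mathcal M_p(\Gamma)\}\subset B(C_u^*(\Gamma))$$ is relatively sequentially compact with respect to the strong operator topology, and its closure in the strong operator topology is given by $$\mathbf X_p(\Gamma)=\{M_\xi:\xi\in\widetilde{\mathcal X}_p(\Gamma)\}.$$
   Context: $\Gamma$ is a countable discrete group, $\{\delta_x\}_{x\in\Gamma}$ the canonical orthonormal basis of $\ell^2(\Gamma)$; for $T\in B(\ell^2(\Gamma))$ put $T(x,y)=\langle\delta_x,T\delta_y\rangle$. $T$ has finite propagation if there is a finite $F\subset\Gamma$ such that $T(x,y)\ne0$ implies $xy^{-1}\in F$. The uniform Roe algebra $C_u^*(\Gamma)$ is the norm closure in $B(\ell^2(\Gamma))$ of the finite propagation operators. For $\varphi:\Gamma\to\mathbb C$ the Schur multiplier $M_\varphi$ (when well defined) is $T\mapsto[\varphi(xy^{-1})T(x,y)]_{x,y\in\Gamma}$ on $B(\ell^2(\Gamma))$; it restricts to a bounded operator on $C_u^*(\Gamma)$, also denoted $M_\varphi$. For $f\in\ell^2(\Gamma)$, $\Phi(f)(s)=\sum_{t\in\Gamma}f(t)\overline{f(ts)}$, and $M_{\Phi(f)}$ is well defined. The strong operator topology on $B(C_u^*(\Gamma))$ is induced by the seminorms $M\mapsto\|M(T)\|$, $T\in C_u^*(\Gamma)$. $\mathcal M_p(\Gamma)=\{f:\Gamma\to[0,1]:\|f\|_p=1\}$, $\mathcal M_p^{\le1}(\Gamma)=\{f:\Gamma\to[0,1]:\|f\|_p\le1\}$.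 The orbit of $f$ under the left action $(\delta_s*f)(x)=f(s^{-1}x)$ is $\widetilde f=\{\delta_s*f:s\in\Gamma\}$; $\Phi(f)$ depends only on $\widetilde f$. $\widetilde{\mathcal X}_p(\Gamma)$ is the set of all empty, finite or countable collections (with multiplicity) $\xi=\{\widetilde\alpha_i\}_{i\in I}$, $I\subset\mathbb N$, with $\alpha_i\in\mathcal M_p^{\le1}(\Gamma)$ and $\sum_{i\in I}\|\alpha_i\|_p^p\le1$. For such $\xi$, $M_\xi=\sum_{\widetilde\alpha\in\xi}M_{\Phi(\alpha)}$ (norm-convergent sum; zero for the empty collection).
   Formalization: The group Γ is assumed countably infinite; for finite Γ the closure formula fails, since the empty collection gives 0 in X_p(Γ), while Φ(f)(e)=‖f‖₂² is bounded below by a positive constant on M_p(Γ), so 0 is not in the closure of S_p(Γ). *)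

theory Defs
  imports "HOL-Analysis.Analysis"
begin

section \<open>Complex normed spaces\<close>

text \<open>The library's bounded operators \<open>'a \<Rightarrow>\<^sub>L 'b\<close> are only real-linear. The class below
  supplies the complex scalar action needed to single out the complex-linear ones.\<close>

class complex_normed_vector = real_normed_vector +
  fixes scaleC :: "complex \<Rightarrow> 'a \<Rightarrow> 'a"  (infixr "*\<^sub>C" 75)
  assumes scaleC_add_right: "a *\<^sub>C (x + y) = a *\<^sub>C x + a *\<^sub>C y"
    and scaleC_add_left: "(a + b) *\<^sub>C x = a *\<^sub>C x + b *\<^sub>C x"
    and scaleC_scaleC: "a *\<^sub>C b *\<^sub>C x = (a * b) *\<^sub>C x"
    and scaleR_scaleC: "r *\<^sub>R x = complex_of_real r *\<^sub>C x"
    and norm_scaleC: "norm (a *\<^sub>C x) = cmod a * norm x"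

lemma scaleC_one: "1 *\<^sub>C x = (x::'a::complex_normed_vector)"
  using scaleR_scaleC[of 1 x, symmetric] unfolding of_real_1 scaleR_one .

lemma scaleC_zero: "0 *\<^sub>C x = (0::'a::complex_normed_vector)"
  using scaleR_scaleC[of 0 x, symmetric] unfolding of_real_0 scaleR_zero_left .

lemma bounded_linear_scaleC: "bounded_linear (\<lambda>x::'a::complex_normed_vector. c *\<^sub>C x)"
  by (rule bounded_linear_intro[where K="cmod c"])
     (simp_all add: scaleC_add_right norm_scaleC scaleR_scaleC scaleC_scaleC mult.commute)

instantiation blinfun :: (real_normed_vector, complex_normed_vector) complex_normed_vector
begin

lift_definition scaleC_blinfun :: "complex \<Rightarrow> ('a \<Rightarrow>\<^sub>L 'b) \<Rightarrow> ('a \<Rightarrow>\<^sub>L 'b)"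
  is "\<lambda>c f x. c *\<^sub>C f x"
  by (rule bounded_linear_compose[OF bounded_linear_scaleC])

instance
proof
  fix a b :: complex and r :: real and x y :: "'a \<Rightarrow>\<^sub>L 'b"
  show "a *\<^sub>C (x + y) = a *\<^sub>C x + a *\<^sub>C y"
    by transfer (simp add: scaleC_add_right)
  show "(a + b) *\<^sub>C x = a *\<^sub>C x + b *\<^sub>C x"
    by transfer (simp add: scaleC_add_left)
  show "a *\<^sub>C b *\<^sub>C x = (a * b) *\<^sub>C x"
    by transfer (simp add: scaleC_scaleC)
  show "r *\<^sub>R x = complex_of_real r *\<^sub>C x"
    by transfer (simp add: scaleR_scaleC)
  have le: "norm (c *\<^sub>C z) \<le> cmod c * norm z" for c and z :: "'a \<Rightarrow>\<^sub>L 'b"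
  proof (rule norm_blinfun_bound)
    fix v
    have "norm (blinfun_apply z v) \<le> norm z * norm v" by (rule norm_blinfun)
    then show "norm (blinfun_apply (c *\<^sub>C z) v) \<le> cmod c * norm z * norm v"
      by (simp add: scaleC_blinfun.rep_eq norm_scaleC mult.assoc mult_left_mono)
  qed simp
  have one: "(1::complex) *\<^sub>C x = x"
    by transfer (simp add: scaleC_one)
  have zero: "(0::complex) *\<^sub>C x = 0"
    by transfer (simp add: scaleC_zero)
  show "norm (a *\<^sub>C x) = cmod a * norm x"
  proof (cases "a = 0")
    case True then show ?thesis by (simp add: zero)
  next
    case False
    have "inverse a *\<^sub>C a *\<^sub>C x = (inverse a * a) *\<^sub>C x"
      by transfer (simp add: scaleC_scaleC)
    then have "inverse a *\<^sub>C a *\<^sub>C x = x" using False one by simp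
    then have "norm x \<le> cmod (inverse a) * norm (a *\<^sub>C x)" using le by metis
    then have "cmod a * norm x \<le> norm (a *\<^sub>C x)"
      using False by (simp add: norm_divide norm_inverse field_simps)
    with le show ?thesis by (metis order_antisym)
  qed
qed

end

definition bounded_ops :: "('a::complex_normed_vector \<Rightarrow>\<^sub>L 'a) set" where
  "bounded_ops = {T. \<forall>c x. blinfun_apply T (c *\<^sub>C x) = c *\<^sub>C blinfun_apply T x}"

text \<open>The library's \<^const>\<open>strong_operator_topology\<close> (pointwise norm convergence, i.e. the
  topology of the seminorms \<open>M \<mapsto> norm (M T)\<close>) restricted to the space
  \<open>B(E)\<close> of bounded complex-linear operators.\<close>

definition SOT :: "('a::complex_normed_vector \<Rightarrow>\<^sub>L 'a) topology" where
  "SOT = subtopology strong_operator_topology bounded_ops"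

definition relatively_sequentially_compactin :: "'a topology \<Rightarrow> 'a set \<Rightarrow> bool" where
  "relatively_sequentially_compactin X S \<longleftrightarrow>
    S \<subseteq> topspace X \<and>
    (\<forall>\<sigma>::nat \<Rightarrow> 'a. range \<sigma> \<subseteq> S \<longrightarrow>
      (\<exists>l r. strict_mono r \<and> limitin X (\<sigma> \<circ> r) l sequentially))"


section \<open>The Hilbert space \<open>\<ell>\<^sup>2\<close>\<close>

typedef 'g ell2 = "{f :: 'g \<Rightarrow> complex. (\<lambda>x. (cmod (f x))\<^sup>2) summable_on UNIV}"
  morphisms ell2_apply Abs_ell2
  by (rule exI[of _ "\<lambda>_. 0"]) simp

setup_lifting type_definition_ell2

lemma ell2_summable_iff:
  fixes f :: "'g \<Rightarrow> complex"
  shows "(\<lambda>x. (cmod (f x))\<^sup>2) summable_on UNIV \<longleftrightarrow>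
         (\<exists>b. \<forall>F. finite F \<longrightarrow> L2_set (\<lambda>x. cmod (f x)) F \<le> b)"
proof
  assume s: "(\<lambda>x. (cmod (f x))\<^sup>2) summable_on UNIV"
  have "L2_set (\<lambda>x. cmod (f x)) F \<le> sqrt (\<Sum>\<^sub>\<infinity>x. (cmod (f x))\<^sup>2)" if "finite F" for F
    unfolding L2_set_def using finite_sum_le_infsum[OF s that] by simp
  then show "\<exists>b. \<forall>F. finite F \<longrightarrow> L2_set (\<lambda>x. cmod (f x)) F \<le> b" by blast
next
  assume "\<exists>b. \<forall>F. finite F \<longrightarrow> L2_set (\<lambda>x. cmod (f x)) F \<le> b"
  then obtain b where b: "\<And>F. finite F \<Longrightarrow> L2_set (\<lambda>x. cmod (f x)) F \<le> b" by blast
  have "(\<Sum>x\<in>F. (cmod (f x))\<^sup>2) \<le> b\<^sup>2" if "finite F" for F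
    using b[OF that] unfolding L2_set_def by (rule sqrt_le_D)
  then have "bdd_above (sum (\<lambda>x. (cmod (f x))\<^sup>2) ` {F. F \<subseteq> UNIV \<and> finite F})"
    by (intro bdd_aboveI[of _ "b\<^sup>2"]) auto
  then show "(\<lambda>x. (cmod (f x))\<^sup>2) summable_on UNIV"
    by (rule nonneg_bdd_above_summable_on[rotated]) simp
qed

lemma ell2_add_closed:
  fixes f g :: "'g \<Rightarrow> complex"
  assumes "(\<lambda>x. (cmod (f x))\<^sup>2) summable_on UNIV" "(\<lambda>x. (cmod (g x))\<^sup>2) summable_on UNIV"
  shows "(\<lambda>x. (cmod (f x + g x))\<^sup>2) summable_on UNIV"
proof -
  obtain b c where b: "\<And>F. finite F \<Longrightarrow> L2_set (\<lambda>x. cmod (f x)) F \<le> b"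
    and c: "\<And>F. finite F \<Longrightarrow> L2_set (\<lambda>x. cmod (g x)) F \<le> c"
    using assms unfolding ell2_summable_iff by blast
  have "L2_set (\<lambda>x. cmod (f x + g x)) F \<le> b + c" if "finite F" for F
  proof -
    have "L2_set (\<lambda>x. cmod (f x + g x)) F \<le> L2_set (\<lambda>x. cmod (f x) + cmod (g x)) F"
      by (rule L2_set_mono) (auto intro: norm_triangle_ineq)
    also have "\<dots> \<le> L2_set (\<lambda>x. cmod (f x)) F + L2_set (\<lambda>x. cmod (g x)) F"
      by (rule L2_set_triangle_ineq)
    finally show ?thesis using b[OF that] c[OF that] by linarith
  qed
  then show ?thesis unfolding ell2_summable_iff by blast
qed

lemma ell2_scale_closed:
  fixes f :: "'g \<Rightarrow> complex"
  assumes "(\<lambda>x. (cmod (f x))\<^sup>2) summable_on UNIV"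
  shows "(\<lambda>x. (cmod (c * f x))\<^sup>2) summable_on UNIV"
  using summable_on_cmult_right[OF assms, of "(cmod c)\<^sup>2"]
  by (simp add: norm_mult power_mult_distrib)

instantiation ell2 :: (type) complex_normed_vector
begin

lift_definition zero_ell2 :: "'a ell2" is "\<lambda>_. 0" by simp

lift_definition plus_ell2 :: "'a ell2 \<Rightarrow> 'a ell2 \<Rightarrow> 'a ell2" is "\<lambda>f g x. f x + g x"
  by (rule ell2_add_closed)

lift_definition uminus_ell2 :: "'a ell2 \<Rightarrow> 'a ell2" is "\<lambda>f x. - f x" by simp

lift_definition minus_ell2 :: "'a ell2 \<Rightarrow> 'a ell2 \<Rightarrow> 'a ell2" is "\<lambda>f g x. f x - g x"
  using ell2_add_closed[of _ "\<lambda>x. - _ x"] by fastforce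

lift_definition scaleC_ell2 :: "complex \<Rightarrow> 'a ell2 \<Rightarrow> 'a ell2" is "\<lambda>c f x. c * f x"
  by (rule ell2_scale_closed)

lift_definition scaleR_ell2 :: "real \<Rightarrow> 'a ell2 \<Rightarrow> 'a ell2" is "\<lambda>r f x. complex_of_real r * f x"
  by (rule ell2_scale_closed)

lift_definition norm_ell2 :: "'a ell2 \<Rightarrow> real" is "\<lambda>f. sqrt (\<Sum>\<^sub>\<infinity>x. (cmod (f x))\<^sup>2)" .

definition dist_ell2 :: "'a ell2 \<Rightarrow> 'a ell2 \<Rightarrow> real" where
  "dist_ell2 a b = norm (a - b)"

definition [code del]:
  "(uniformity :: ('a ell2 \<times> 'a ell2) filter) = (INF e\<in>{0 <..}. principal {(x, y). dist x y < e})"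

definition open_ell2 :: "'a ell2 set \<Rightarrow> bool" where
  [code del]: "open_ell2 S = (\<forall>x\<in>S. \<forall>\<^sub>F (x', y) in uniformity. x' = x \<longrightarrow> y \<in> S)"

definition sgn_ell2 :: "'a ell2 \<Rightarrow> 'a ell2" where
  "sgn_ell2 x = inverse (norm x) *\<^sub>R x"

instance
proof
  fix x y z :: "'a ell2" and a b :: real and c d :: complex
  show "x + y + z = x + (y + z)" by transfer (simp add: add.assoc)
  show "x + y = y + x" by transfer (simp add: add.commute)
  show "0 + x = x" by transfer simp
  show "- x + x = 0" by transfer simp
  show "x - y = x + - y" by transfer simp
  show "a *\<^sub>R (x + y) = a *\<^sub>R x + a *\<^sub>R y" by transfer (simp add: algebra_simps)
  show "(a + b) *\<^sub>R x = a *\<^sub>R x + b *\<^sub>R x" by transfer (simp add: algebra_simps)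
  show "a *\<^sub>R b *\<^sub>R x = (a * b) *\<^sub>R x" by transfer (simp add: algebra_simps)
  show "1 *\<^sub>R x = x" by transfer simp
  show "dist x y = norm (x - y)" by (rule dist_ell2_def)
  show "sgn x = inverse (norm x) *\<^sub>R x" by (rule sgn_ell2_def)
  show "uniformity = (INF e\<in>{0 <..}. principal {(x, y :: 'a ell2). dist x y < e})"
    by (rule uniformity_ell2_def)
  show "open S \<longleftrightarrow> (\<forall>x\<in>S. \<forall>\<^sub>F (x', y) in uniformity. x' = x \<longrightarrow> y \<in> S)" for S :: "'a ell2 set"
    by (rule open_ell2_def)
  show "norm x = 0 \<longleftrightarrow> x = 0"
  proof transfer
    fix f :: "'a \<Rightarrow> complex"
    assume s: "(\<lambda>x. (cmod (f x))\<^sup>2) summable_on UNIV"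
    have "(\<Sum>\<^sub>\<infinity>x. (cmod (f x))\<^sup>2) = 0 \<Longrightarrow> f = (\<lambda>_. 0)"
    proof
      fix x assume "(\<Sum>\<^sub>\<infinity>x. (cmod (f x))\<^sup>2) = 0"
      then have "(cmod (f x))\<^sup>2 = 0"
        using nonneg_infsum_le_0D[OF _ s, of x] by auto
      then show "f x = 0" by simp
    qed
    then show "sqrt (\<Sum>\<^sub>\<infinity>x. (cmod (f x))\<^sup>2) = 0 \<longleftrightarrow> f = (\<lambda>_. 0)" by auto
  qed
  show "norm (x + y) \<le> norm x + norm y"
  proof transfer
    fix f g :: "'a \<Rightarrow> complex"
    assume sf: "(\<lambda>x. (cmod (f x))\<^sup>2) summable_on UNIV"
      and sg: "(\<lambda>x. (cmod (g x))\<^sup>2) summable_on UNIV"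
    let ?n = "\<lambda>h. sqrt (\<Sum>\<^sub>\<infinity>x. (cmod (h x))\<^sup>2)"
    have le: "L2_set (\<lambda>x. cmod (h x)) F \<le> ?n h"
      if "(\<lambda>x. (cmod (h x))\<^sup>2) summable_on UNIV" "finite F" for h :: "'a \<Rightarrow> complex" and F
      unfolding L2_set_def using finite_sum_le_infsum[OF that] by simp
    have "(\<Sum>\<^sub>\<infinity>x. (cmod (f x + g x))\<^sup>2) \<le> (?n f + ?n g)\<^sup>2"
    proof (rule infsum_le_finite_sums[OF ell2_add_closed[OF sf sg]])
      fix F :: "'a set" assume F: "finite F"
      have "L2_set (\<lambda>x. cmod (f x + g x)) F \<le> L2_set (\<lambda>x. cmod (f x) + cmod (g x)) F"
        by (rule L2_set_mono) (auto intro: norm_triangle_ineq)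
      also have "\<dots> \<le> L2_set (\<lambda>x. cmod (f x)) F + L2_set (\<lambda>x. cmod (g x)) F"
        by (rule L2_set_triangle_ineq)
      also have "\<dots> \<le> ?n f + ?n g" using le[OF sf F] le[OF sg F] by linarith
      finally show "(\<Sum>x\<in>F. (cmod (f x + g x))\<^sup>2) \<le> (?n f + ?n g)\<^sup>2"
        unfolding L2_set_def by (rule sqrt_le_D)
    qed
    then show "?n (\<lambda>x. f x + g x) \<le> ?n f + ?n g"
      by (intro real_le_lsqrt) (auto intro!: add_nonneg_nonneg infsum_nonneg)
  qed
  show nC: "norm (c *\<^sub>C x) = cmod c * norm x" for c :: complex
    by transfer (simp add: norm_mult power_mult_distrib infsum_cmult_right' real_sqrt_mult)
  show RC: "a *\<^sub>R x = complex_of_real a *\<^sub>C x" by transfer simp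
  show "norm (a *\<^sub>R x) = \<bar>a\<bar> * norm x" by (simp add: RC nC)
  show "c *\<^sub>C (x + y) = c *\<^sub>C x + c *\<^sub>C y" by transfer (simp add: algebra_simps)
  show "(c + d) *\<^sub>C x = c *\<^sub>C x + d *\<^sub>C x" by transfer (simp add: algebra_simps)
  show "c *\<^sub>C d *\<^sub>C x = (c * d) *\<^sub>C x" by transfer (simp add: algebra_simps)
qed

end

lift_definition delta :: "'g \<Rightarrow> 'g ell2" is "\<lambda>x y. if y = x then 1 else 0"
proof -
  fix x :: 'g
  have "(\<lambda>y. (cmod (if y = x then 1 else 0))\<^sup>2) summable_on {x}" by simp
  then show "(\<lambda>y. (cmod (if y = x then 1 else 0))\<^sup>2) summable_on UNIV"
    by (rule summable_on_cong_neutral[THEN iffD1, rotated -1]) auto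
qed

definition cinner_ell2 :: "'g ell2 \<Rightarrow> 'g ell2 \<Rightarrow> complex" where
  "cinner_ell2 f g = (\<Sum>\<^sub>\<infinity>x. cnj (ell2_apply f x) * ell2_apply g x)"

definition entry :: "('g ell2 \<Rightarrow>\<^sub>L 'g ell2) \<Rightarrow> 'g \<Rightarrow> 'g \<Rightarrow> complex" where
  "entry T x y = cinner_ell2 (delta x) (blinfun_apply T (delta y))"


section \<open>The uniform Roe algebra\<close>

text \<open>Groups are types of class \<^class>\<open>group_add\<close>, which is the library's class of
  \<^emph>\<open>not necessarily commutative\<close> groups, in additive notation: the product \<open>x y\<close> is
  written \<open>x + y\<close>, the product of \<open>x\<close> with the inverse of \<open>y\<close> is \<open>x - y\<close>, and the product of
  the inverse of \<open>s\<close> with \<open>x\<close> is \<open>- s + x\<close>.\<close>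

definition finite_propagation :: "('g::group_add ell2 \<Rightarrow>\<^sub>L 'g ell2) \<Rightarrow> bool" where
  "finite_propagation T \<longleftrightarrow> (\<exists>F. finite F \<and> (\<forall>x y. entry T x y \<noteq> 0 \<longrightarrow> x - y \<in> F))"

definition uniform_Roe_algebra :: "('g::group_add ell2 \<Rightarrow>\<^sub>L 'g ell2) set" where
  "uniform_Roe_algebra = closure {T \<in> bounded_ops. finite_propagation T}"

lemma ell2_apply_scaleC [simp]: "ell2_apply (c *\<^sub>C f) x = c * ell2_apply f x"
  by (simp add: scaleC_ell2.rep_eq)

lemma cinner_delta [simp]: "cinner_ell2 (delta x) f = ell2_apply f x"
proof -
  have "cinner_ell2 (delta x) f = (\<Sum>\<^sub>\<infinity>y\<in>{x}. cnj (ell2_apply (delta x) y) * ell2_apply f y)"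
    unfolding cinner_ell2_def by (rule infsum_cong_neutral) (auto simp: delta.rep_eq)
  then show ?thesis by (simp add: delta.rep_eq)
qed

lemma entry_add: "entry (S + T) x y = entry S x y + entry T x y"
  by (simp add: entry_def blinfun.add_left plus_ell2.rep_eq)

lemma entry_scaleC: "entry (c *\<^sub>C T) x y = c * entry T x y"
  by (simp add: entry_def scaleC_blinfun.rep_eq)

lemma uniform_Roe_algebra_zero: "0 \<in> uniform_Roe_algebra"
  unfolding uniform_Roe_algebra_def
proof (rule subsetD[OF closure_subset])
  have "c *\<^sub>C (0::'a ell2) = 0" for c by transfer simp
  then have "(0::'a ell2 \<Rightarrow>\<^sub>L 'a ell2) \<in> bounded_ops"
    by (simp add: bounded_ops_def)
  moreover have "entry (0::'a ell2 \<Rightarrow>\<^sub>L 'a ell2) x y = 0" for x y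
    by (simp add: entry_def zero_ell2.rep_eq)
  then have "finite_propagation (0::'a ell2 \<Rightarrow>\<^sub>L 'a ell2)"
    unfolding finite_propagation_def by (intro exI[of _ "{}"]) simp
  ultimately show "(0::'a ell2 \<Rightarrow>\<^sub>L 'a ell2) \<in> {T \<in> bounded_ops. finite_propagation T}"
    by simp
qed

lemma finite_propagation_add:
  assumes "finite_propagation S" "finite_propagation T"
  shows "finite_propagation (S + T)"
proof -
  obtain F where "finite F" and F: "\<And>x y. entry S x y \<noteq> 0 \<Longrightarrow> x - y \<in> F"
    using assms(1) unfolding finite_propagation_def by metis
  obtain G where "finite G" and G: "\<And>x y. entry T x y \<noteq> 0 \<Longrightarrow> x - y \<in> G"
    using assms(2) unfolding finite_propagation_def by metis
  have "x - y \<in> F \<union> G" if "entry (S + T) x y \<noteq> 0" for x y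
  proof (cases "entry S x y = 0")
    case True
    with that have "entry T x y \<noteq> 0" by (simp add: entry_add)
    then show ?thesis using G by simp
  next
    case False
    then show ?thesis using F by simp
  qed
  with \<open>finite F\<close> \<open>finite G\<close> show ?thesis
    unfolding finite_propagation_def by (intro exI[of _ "F \<union> G"]) simp
qed

lemma finite_propagation_scaleC:
  assumes "finite_propagation T"
  shows "finite_propagation (c *\<^sub>C T)"
proof -
  obtain F where "finite F" and F: "\<And>x y. entry T x y \<noteq> 0 \<Longrightarrow> x - y \<in> F"
    using assms unfolding finite_propagation_def by metis
  then show ?thesis
    unfolding finite_propagation_def by (intro exI[of _ F]) (simp add: entry_scaleC)
qed

lemma bounded_ops_add: "S \<in> bounded_ops \<Longrightarrow> T \<in> bounded_ops \<Longrightarrow> S + T \<in> bounded_ops"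
  by (simp add: bounded_ops_def blinfun.add_left scaleC_add_right)

lemma bounded_ops_scaleC: "T \<in> bounded_ops \<Longrightarrow> c *\<^sub>C T \<in> bounded_ops"
  by (simp add: bounded_ops_def scaleC_blinfun.rep_eq scaleC_scaleC mult.commute)

lemma uniform_Roe_algebra_add:
  assumes "S \<in> uniform_Roe_algebra" "T \<in> uniform_Roe_algebra"
  shows "S + T \<in> uniform_Roe_algebra"
proof -
  obtain s where s: "\<And>n. s n \<in> bounded_ops" "\<And>n. finite_propagation (s n)" "s \<longlonglongrightarrow> S"
    using assms(1) unfolding uniform_Roe_algebra_def closure_sequential mem_Collect_eq by metis
  obtain t where t: "\<And>n. t n \<in> bounded_ops" "\<And>n. finite_propagation (t n)" "t \<longlonglongrightarrow> T"
    using assms(2) unfolding uniform_Roe_algebra_def closure_sequential mem_Collect_eq by metis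
  show ?thesis
    unfolding uniform_Roe_algebra_def closure_sequential mem_Collect_eq
    by (rule exI[of _ "\<lambda>n. s n + t n"])
       (intro conjI allI bounded_ops_add finite_propagation_add tendsto_add s t)
qed

lemma uniform_Roe_algebra_scaleC:
  assumes "T \<in> uniform_Roe_algebra"
  shows "c *\<^sub>C T \<in> uniform_Roe_algebra"
proof -
  obtain t where t: "\<And>n. t n \<in> bounded_ops" "\<And>n. finite_propagation (t n)" "t \<longlonglongrightarrow> T"
    using assms unfolding uniform_Roe_algebra_def closure_sequential mem_Collect_eq by metis
  have "(\<lambda>n. c *\<^sub>C t n) \<longlonglongrightarrow> c *\<^sub>C T"
    by (rule bounded_linear.tendsto[OF bounded_linear_scaleC t(3)])
  with t(1,2) have "\<forall>n. c *\<^sub>C t n \<in> {T \<in> bounded_ops. finite_propagation T}"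
      "(\<lambda>n. c *\<^sub>C t n) \<longlonglongrightarrow> c *\<^sub>C T"
    using bounded_ops_scaleC finite_propagation_scaleC by blast+
  then show ?thesis
    unfolding uniform_Roe_algebra_def closure_sequential
    by (intro exI[of _ "\<lambda>n. c *\<^sub>C t n"] conjI)
qed

lemma uniform_Roe_algebra_uminus:
  assumes "T \<in> uniform_Roe_algebra"
  shows "- T \<in> uniform_Roe_algebra"
proof -
  have "- T = complex_of_real (- 1) *\<^sub>C T"
    by (rule trans[OF scaleR_minus1_left[symmetric] scaleR_scaleC])
  also have "\<dots> \<in> uniform_Roe_algebra"
    by (rule uniform_Roe_algebra_scaleC[OF assms])
  finally show ?thesis .
qed

text \<open>\<open>C\<^sub>u\<^sup>*(\<Gamma>)\<close> as a normed space in its own right, so that the library's operator spaces and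
  strong operator topology apply to it.\<close>

typedef (overloaded) 'g roe = "uniform_Roe_algebra :: ('g::group_add ell2 \<Rightarrow>\<^sub>L 'g ell2) set"
  morphisms op_of_roe Abs_roe
  using uniform_Roe_algebra_zero by blast

setup_lifting type_definition_roe

instantiation roe :: (group_add) complex_normed_vector
begin

lift_definition zero_roe :: "'a roe" is 0 by (rule uniform_Roe_algebra_zero)

lift_definition plus_roe :: "'a roe \<Rightarrow> 'a roe \<Rightarrow> 'a roe" is "(+)"
  by (rule uniform_Roe_algebra_add)

lift_definition uminus_roe :: "'a roe \<Rightarrow> 'a roe" is uminus
  by (rule uniform_Roe_algebra_uminus)

lift_definition minus_roe :: "'a roe \<Rightarrow> 'a roe \<Rightarrow> 'a roe" is "(-)"
  by (metis diff_conv_add_uminus uniform_Roe_algebra_add uniform_Roe_algebra_uminus)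

lift_definition scaleC_roe :: "complex \<Rightarrow> 'a roe \<Rightarrow> 'a roe" is "(*\<^sub>C)"
  by (rule uniform_Roe_algebra_scaleC)

lift_definition scaleR_roe :: "real \<Rightarrow> 'a roe \<Rightarrow> 'a roe" is "(*\<^sub>R)"
  unfolding scaleR_scaleC by (rule uniform_Roe_algebra_scaleC)

lift_definition norm_roe :: "'a roe \<Rightarrow> real" is norm .

definition dist_roe :: "'a roe \<Rightarrow> 'a roe \<Rightarrow> real" where
  "dist_roe a b = norm (a - b)"

definition [code del]:
  "(uniformity :: ('a roe \<times> 'a roe) filter) = (INF e\<in>{0 <..}. principal {(x, y). dist x y < e})"

definition open_roe :: "'a roe set \<Rightarrow> bool" where
  [code del]: "open_roe S = (\<forall>x\<in>S. \<forall>\<^sub>F (x', y) in uniformity. x' = x \<longrightarrow> y \<in> S)"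

definition sgn_roe :: "'a roe \<Rightarrow> 'a roe" where
  "sgn_roe x = inverse (norm x) *\<^sub>R x"

instance
proof
  fix x y z :: "'a roe" and a b :: real and c d :: complex
  show "x + y + z = x + (y + z)" by transfer (simp add: add.assoc)
  show "x + y = y + x" by transfer (simp add: add.commute)
  show "0 + x = x" by transfer simp
  show "- x + x = 0" by transfer simp
  show "x - y = x + - y" by transfer simp
  show "a *\<^sub>R (x + y) = a *\<^sub>R x + a *\<^sub>R y" by transfer (simp add: scaleR_add_right)
  show "(a + b) *\<^sub>R x = a *\<^sub>R x + b *\<^sub>R x" by transfer (simp add: scaleR_add_left)
  show "a *\<^sub>R b *\<^sub>R x = (a * b) *\<^sub>R x" by transfer simp
  show "1 *\<^sub>R x = x" by transfer simp
  show "dist x y = norm (x - y)" by (rule dist_roe_def)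
  show "sgn x = inverse (norm x) *\<^sub>R x" by (rule sgn_roe_def)
  show "uniformity = (INF e\<in>{0 <..}. principal {(x, y :: 'a roe). dist x y < e})"
    by (rule uniformity_roe_def)
  show "open S \<longleftrightarrow> (\<forall>x\<in>S. \<forall>\<^sub>F (x', y) in uniformity. x' = x \<longrightarrow> y \<in> S)" for S :: "'a roe set"
    by (rule open_roe_def)
  show "norm x = 0 \<longleftrightarrow> x = 0" by transfer simp
  show "norm (x + y) \<le> norm x + norm y" by transfer (rule norm_triangle_ineq)
  show "norm (a *\<^sub>R x) = \<bar>a\<bar> * norm x" by transfer simp
  show "norm (c *\<^sub>C x) = cmod c * norm x" by transfer (rule norm_scaleC)
  show "a *\<^sub>R x = complex_of_real a *\<^sub>C x" by transfer (rule scaleR_scaleC)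
  show "c *\<^sub>C (x + y) = c *\<^sub>C x + c *\<^sub>C y" by transfer (rule scaleC_add_right)
  show "(c + d) *\<^sub>C x = c *\<^sub>C x + d *\<^sub>C x" by transfer (rule scaleC_add_left)
  show "c *\<^sub>C d *\<^sub>C x = (c * d) *\<^sub>C x" by transfer (rule scaleC_scaleC)
qed

end


section \<open>Schur multipliers\<close>

text \<open>\<open>schur_multiplier \<phi> T\<close> is the operator with matrix \<open>[\<phi>(x - y) T(x,y)]\<close>; at most
  one bounded operator has these entries, and if none does the value is arbitrary. \<open>M_op \<phi>\<close> is the
  restriction to \<open>C\<^sub>u\<^sup>*(\<Gamma>)\<close>; it is used only for \<open>\<phi> = \<Phi> f\<close> with \<open>f\<close> square-summable, where the
  multiplier is everywhere defined, bounded, and preserves \<open>C\<^sub>u\<^sup>*(\<Gamma>)\<close>.\<close>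

definition schur_multiplier ::
    "('g::group_add \<Rightarrow> complex) \<Rightarrow> ('g ell2 \<Rightarrow>\<^sub>L 'g ell2) \<Rightarrow> ('g ell2 \<Rightarrow>\<^sub>L 'g ell2)" where
  "schur_multiplier \<phi> T =
    (THE S. S \<in> bounded_ops \<and> (\<forall>x y. entry S x y = \<phi> (x - y) * entry T x y))"

definition M_op :: "('g::group_add \<Rightarrow> complex) \<Rightarrow> 'g roe \<Rightarrow>\<^sub>L 'g roe" where
  "M_op \<phi> = Blinfun (\<lambda>T. Abs_roe (schur_multiplier \<phi> (op_of_roe T)))"

definition \<Phi> :: "('g::group_add \<Rightarrow> complex) \<Rightarrow> 'g \<Rightarrow> complex" where
  "\<Phi> f s = (\<Sum>\<^sub>\<infinity>t. f t * cnj (f (t + s)))"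


section \<open>The sets \<open>S\<^sub>p\<close> and \<open>X\<^sub>p\<close>\<close>

definition lp_summable :: "real \<Rightarrow> ('g \<Rightarrow> complex) \<Rightarrow> bool" where
  "lp_summable p f \<longleftrightarrow> (\<lambda>x. cmod (f x) powr p) summable_on UNIV"

definition lp_norm :: "real \<Rightarrow> ('g \<Rightarrow> complex) \<Rightarrow> real" where
  "lp_norm p f = (\<Sum>\<^sub>\<infinity>x. cmod (f x) powr p) powr (1 / p)"

text \<open>The summability conjunct matters in \<open>lp_ball\<close>: \<^const>\<open>infsum\<close> is \<open>0\<close> on families that are
  not summable.\<close>

definition lp_sphere :: "real \<Rightarrow> ('g \<Rightarrow> complex) set" where
  "lp_sphere p = {f. (\<forall>x. f x \<in> complex_of_real ` {0..1}) \<and> lp_summable p f \<and> lp_norm p f = 1}"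

definition lp_ball :: "real \<Rightarrow> ('g \<Rightarrow> complex) set" where
  "lp_ball p = {f. (\<forall>x. f x \<in> complex_of_real ` {0..1}) \<and> lp_summable p f \<and> lp_norm p f \<le> 1}"

definition left_translate :: "'g::group_add \<Rightarrow> ('g \<Rightarrow> complex) \<Rightarrow> 'g \<Rightarrow> complex" where
  "left_translate s f x = f (- s + x)"

definition orbit :: "('g::group_add \<Rightarrow> complex) \<Rightarrow> ('g \<Rightarrow> complex) set" where
  "orbit f = {left_translate s f | s. True}"

lemma \<Phi>_left_translate: "\<Phi> (left_translate s f) = \<Phi> f"
proof
  fix u
  have "bij_betw (\<lambda>t. - s + t) UNIV UNIV"
    by (rule bij_betw_byWitness[where f'="\<lambda>t. s + t"]) (auto simp: add.assoc[symmetric])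
  from infsum_reindex_bij_betw[OF this, of "\<lambda>t. f t * cnj (f (t + u))"]
  show "\<Phi> (left_translate s f) u = \<Phi> f u"
    by (simp add: \<Phi>_def left_translate_def add.assoc)
qed

text \<open>\<open>\<Phi>\<close> is constant on orbits, so the image of an orbit under \<open>\<Phi>\<close> is a singleton.\<close>

definition \<Phi>_orbit :: "('g::group_add \<Rightarrow> complex) set \<Rightarrow> 'g \<Rightarrow> complex" where
  "\<Phi>_orbit A = the_elem (\<Phi> ` A)"

lemma \<Phi>_orbit_orbit: "\<Phi>_orbit (orbit f) = \<Phi> f"
proof -
  have "orbit f \<noteq> {}" and "\<And>g. g \<in> orbit f \<Longrightarrow> \<Phi> g = \<Phi> f"
    by (auto simp: orbit_def \<Phi>_left_translate)
  then have "\<Phi> ` orbit f = {\<Phi> f}" by force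
  then show ?thesis by (simp add: \<Phi>_orbit_def)
qed

text \<open>A collection with multiplicities indexed by some \<open>I \<subseteq> \<nat>\<close> is a partial function on the
  naturals with domain \<open>I\<close>. Two partial functions that differ by a re-indexing stand for the
  same collection and have the same sum \<open>M_collection\<close>.\<close>

definition orbit_collections :: "real \<Rightarrow> (nat \<rightharpoonup> ('g::group_add \<Rightarrow> complex) set) set" where
  "orbit_collections p =
    {\<xi>. \<exists>\<alpha>. (\<forall>i\<in>dom \<xi>. \<xi> i = Some (orbit (\<alpha> i)) \<and> \<alpha> i \<in> lp_ball p) \<and>
          (\<lambda>i. lp_norm p (\<alpha> i) powr p) summable_on dom \<xi> \<and>
          (\<Sum>\<^sub>\<infinity>i\<in>dom \<xi>. lp_norm p (\<alpha> i) powr p) \<le> 1}"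

definition M_collection :: "(nat \<rightharpoonup> ('g::group_add \<Rightarrow> complex) set) \<Rightarrow> 'g roe \<Rightarrow>\<^sub>L 'g roe" where
  "M_collection \<xi> = (\<Sum>\<^sub>\<infinity>i\<in>dom \<xi>. M_op (\<Phi>_orbit (the (\<xi> i))))"

definition S_set :: "real \<Rightarrow> ('g::group_add roe \<Rightarrow>\<^sub>L 'g roe) set" where
  "S_set p = {M_op (\<Phi> f) | f. f \<in> lp_sphere p}"

definition X_set :: "real \<Rightarrow> ('g::group_add roe \<Rightarrow>\<^sub>L 'g roe) set" where
  "X_set p = {M_collection \<xi> | \<xi>. \<xi> \<in> orbit_collections p}"

end

theory Submission
  imports Defs "HOL-Complex_Analysis.Great_Picard"
begin

text \<open>
  Write \<open>\<phi>\<close> for the symbol of a multiplier. All symbols in sight are autocorrelations of families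
  \<open>A (i, _)\<close> of nonnegative functions on the group with total \<open>p\<close>-mass \<open>\<Sum> A (i, t) powr p\<close> at most
  \<open>1\<close>, that is, \<open>\<phi> s = \<Sum> A (i, t) * A (i, t + s)\<close>, both sums over all pairs \<open>(i, t)\<close>. A single
  function of mass exactly \<open>1\<close> gives an element of \<open>S_set p\<close> (lemma \<open>S_set_eq\<close>), a sequence of functions
  gives an element of \<open>X_set p\<close> (lemma \<open>X_set_eq\<close>). The theorem thus splits into an operator part and
  a combinatorial part.

  Operators. Since \<open>\<phi> (x - y) = \<Sum>\<^sub>u v u x * v u y\<close> with \<open>\<Sum>\<^sub>u (v u x)\<^sup>2 \<le> 1\<close>, the multiplier is
  a sum of operators \<open>D\<^sub>u T D\<^sub>u\<close> with \<open>D\<^sub>u\<close> diagonal, and has norm at most \<open>1\<close>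
  (\<open>schur_product_exists\<close>). On an operator of finite propagation a multiplier sees only finitely many
  values of its symbol, so for these uniformly bounded multipliers pointwise convergence of the symbols
  already gives strong convergence (\<open>M_op_tendsto\<close>). Conversely the translation by \<open>s\<close> recovers
  \<open>\<phi> s\<close> from the multiplier. Everything is therefore a statement about pointwise limits of
  autocorrelations.

  Compactness (\<open>autocorr_sequentially_compact\<close>). Enumerate the support of the \<open>n\<close>-th function by
  decreasing values as \<open>t n 0, t n 1, \<dots>\<close>; then the \<open>k\<close>-th value is at most \<open>(1 / (k + 1)) powr (1 / p)\<close>
  whatever \<open>n\<close> is. Along a diagonal subsequence every value \<open>f n (t n k)\<close> converges and every
  displacement from \<open>t n j\<close> to \<open>t n k\<close> is eventually constant or eventually avoids each fixed group
  element. Points at eventually constant displacement form one cluster; each cluster contributes one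
  member of the limiting collection, and distinct clusters drift apart and do not interact.
  Thinly spread \<open>p\<close>-mass may disappear in the limit, but the autocorrelations do not notice: for
  \<open>p < 2\<close> values below \<open>\<eta>\<close> contribute at most \<open>2 * \<eta> powr (2 - p)\<close> (\<open>sum_mult_small_le\<close>).

  Density (\<open>family_autocorr_approx\<close>). A finite truncation of a family is realised by a single function
  by placing the members at far apart positions; the missing \<open>\<ell>\<^sup>p\<close> mass is spread thinly over many
  points, which by the same estimate hardly changes the autocorrelation.
\<close>

section \<open>Matrices of operators on \<open>\<ell>\<^sup>2\<close>\<close>

lemma nonneg_summable_bounded:
  fixes f :: "'a \<Rightarrow> real"
  assumes "\<And>x. 0 \<le> f x" and "\<And>F. finite F \<Longrightarrow> sum f F \<le> b"
  shows "f summable_on A" and "infsum f A \<le> b"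
proof -
  show *: "f summable_on A"
    by (rule nonneg_bdd_above_summable_on) (use assms in \<open>auto intro!: bdd_aboveI[of _ b]\<close>)
  show "infsum f A \<le> b"
    using assms by (intro infsum_le_finite_sums[OF *]) auto
qed

lemma has_sum_finite_sum:
  fixes f :: "'i \<Rightarrow> 'a \<Rightarrow> 'b::topological_comm_monoid_add"
  assumes "\<And>i. i \<in> I \<Longrightarrow> (f i has_sum s i) A"
  shows "((\<lambda>x. \<Sum>i\<in>I. f i x) has_sum sum s I) A"
  using assms by (induction I rule: infinite_finite_induct) (auto intro: has_sum_add)

lemma ell2_eqI: "(\<And>x. ell2_apply f x = ell2_apply g x) \<Longrightarrow> f = g"
  by (metis ell2_apply_inject ext)

lemma ell2_apply_simps [simp]:
  "ell2_apply (f + g) x = ell2_apply f x + ell2_apply g x"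
  "ell2_apply (f - g) x = ell2_apply f x - ell2_apply g x"
  "ell2_apply 0 x = 0"
  "ell2_apply (r *\<^sub>R f) x = complex_of_real r * ell2_apply f x"
  "ell2_apply (delta y) x = (if x = y then 1 else 0)"
  by (simp_all add: plus_ell2.rep_eq minus_ell2.rep_eq zero_ell2.rep_eq scaleR_ell2.rep_eq
      delta.rep_eq)

lemma ell2_apply_sum [simp]: "ell2_apply (\<Sum>i\<in>I. f i) x = (\<Sum>i\<in>I. ell2_apply (f i) x)"
  by (induction I rule: infinite_finite_induct) auto

lemma entry_eq_ell2_apply: "entry T x y = ell2_apply (blinfun_apply T (delta y)) x"
  by (simp add: entry_def)

lemma norm_ell2_has_sum: "((\<lambda>x. (cmod (ell2_apply f x))\<^sup>2) has_sum (norm f)\<^sup>2) UNIV"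
proof -
  have s: "(\<lambda>x. (cmod (ell2_apply f x))\<^sup>2) summable_on UNIV" using ell2_apply[of f] by simp
  have "(norm f)\<^sup>2 = (\<Sum>\<^sub>\<infinity>x. (cmod (ell2_apply f x))\<^sup>2)"
    by (simp add: norm_ell2.rep_eq infsum_nonneg)
  with s show ?thesis by simp
qed

lemma sum_le_norm_ell2: "finite F \<Longrightarrow> (\<Sum>x\<in>F. (cmod (ell2_apply f x))\<^sup>2) \<le> (norm f)\<^sup>2"
  by (rule finite_sum_le_has_sum[OF norm_ell2_has_sum]) auto

lemma norm_ell2_leI:
  assumes "0 \<le> b" and "\<And>F. finite F \<Longrightarrow> (\<Sum>x\<in>F. (cmod (ell2_apply f x))\<^sup>2) \<le> b\<^sup>2"
  shows "norm f \<le> b"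
proof -
  have "(norm f)\<^sup>2 \<le> b\<^sup>2"
    by (rule has_sum_le_finite_sums[OF norm_ell2_has_sum]) (use assms in auto)
  then show ?thesis using assms(1) by (rule power2_le_imp_le)
qed

lemma cmod_ell2_apply_le: "cmod (ell2_apply f x) \<le> norm f"
  using sum_le_norm_ell2[of "{x}" f] by (simp add: power2_le_iff_abs_le)

lemma bounded_linear_ell2_apply: "bounded_linear (\<lambda>f. ell2_apply f x)"
  by (rule bounded_linear_intro[where K=1]) (auto simp: cmod_ell2_apply_le scaleR_conv_of_real)

lemma ell2_apply_Abs:
  assumes "\<And>F. finite F \<Longrightarrow> (\<Sum>x\<in>F. (cmod (f x))\<^sup>2) \<le> b"
  shows "ell2_apply (Abs_ell2 f) = f"
  by (rule Abs_ell2_inverse) (use nonneg_summable_bounded(1)[OF _ assms] in auto)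

lemma norm_delta: "norm (delta x) = 1"
proof -
  have "((\<lambda>y. (cmod (ell2_apply (delta x) y))\<^sup>2) has_sum 1) UNIV"
    by (rule has_sum_finite_neutralI[of "{x}"]) auto
  then have "(norm (delta x))\<^sup>2 = 1" by (rule has_sum_unique[OF norm_ell2_has_sum])
  then show ?thesis using real_sqrt_unique[OF _ norm_ge_zero] by fastforce
qed

lemma norm_entry_le: "cmod (entry T x y) \<le> norm T"
  using cmod_ell2_apply_le[of "blinfun_apply T (delta y)" x] norm_blinfun[of T "delta y"]
  by (simp add: entry_eq_ell2_apply norm_delta)

lemma entry_diff: "entry (S - T) x y = entry S x y - entry T x y"
  by (simp add: entry_eq_ell2_apply blinfun.diff_left)

text \<open>The remainder after a finite partial sum has squared norm \<open>(norm f)\<^sup>2\<close> minus the squared norm of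
  that partial sum, and this tends to zero by the definition of the norm.\<close>

lemma delta_expansion: "((\<lambda>x. ell2_apply f x *\<^sub>C delta x) has_sum f) UNIV"
proof -
  define s where "s = (\<lambda>F. \<Sum>x\<in>F. ell2_apply f x *\<^sub>C delta x)"
  have apply_s: "ell2_apply (s F) x = (if x \<in> F then ell2_apply f x else 0)" if "finite F" for F x
    using that by (simp add: s_def sum.delta if_distrib cong: if_cong)
  have bound: "norm (s F - f) \<le> sqrt ((norm f)\<^sup>2 - (\<Sum>x\<in>F. (cmod (ell2_apply f x))\<^sup>2))"
    if F: "finite F" for F
  proof (rule norm_ell2_leI)
    show "0 \<le> sqrt ((norm f)\<^sup>2 - (\<Sum>x\<in>F. (cmod (ell2_apply f x))\<^sup>2))"
      using sum_le_norm_ell2[OF F, of f] by simp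
    fix G :: "'a set" assume G: "finite G"
    have "(\<Sum>x\<in>G. (cmod (ell2_apply (s F - f) x))\<^sup>2) = (\<Sum>x\<in>G - F. (cmod (ell2_apply f x))\<^sup>2)"
      using G F by (intro sum.mono_neutral_cong_right) (auto simp: apply_s[OF F])
    moreover have "(\<Sum>x\<in>G - F. (cmod (ell2_apply f x))\<^sup>2) + (\<Sum>x\<in>F. (cmod (ell2_apply f x))\<^sup>2)
        = (\<Sum>x\<in>G \<union> F. (cmod (ell2_apply f x))\<^sup>2)"
      using F G by (subst sum.union_disjoint[symmetric]) (auto intro!: sum.cong)
    ultimately show "(\<Sum>x\<in>G. (cmod (ell2_apply (s F - f) x))\<^sup>2)
        \<le> (sqrt ((norm f)\<^sup>2 - (\<Sum>x\<in>F. (cmod (ell2_apply f x))\<^sup>2)))\<^sup>2"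
      using sum_le_norm_ell2[of "G \<union> F" f] sum_le_norm_ell2[OF F, of f] F G by simp
  qed
  have "((\<lambda>F. sqrt ((norm f)\<^sup>2 - (\<Sum>x\<in>F. (cmod (ell2_apply f x))\<^sup>2)))
      \<longlongrightarrow> sqrt ((norm f)\<^sup>2 - (norm f)\<^sup>2)) (finite_subsets_at_top UNIV)"
    using norm_ell2_has_sum[of f] unfolding has_sum_def by (intro tendsto_intros)
  then have "((\<lambda>F. sqrt ((norm f)\<^sup>2 - (\<Sum>x\<in>F. (cmod (ell2_apply f x))\<^sup>2))) \<longlongrightarrow> 0)
      (finite_subsets_at_top UNIV)" by simp
  then have "((\<lambda>F. s F - f) \<longlongrightarrow> 0) (finite_subsets_at_top UNIV)"
    by (rule Lim_null_comparison[rotated])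
       (use bound in \<open>auto intro: eventually_finite_subsets_at_top_weakI\<close>)
  then show ?thesis unfolding has_sum_def s_def by (rule LIM_zero_cancel)
qed

lemma bounded_opsD: "T \<in> bounded_ops \<Longrightarrow> blinfun_apply T (c *\<^sub>C x) = c *\<^sub>C blinfun_apply T x"
  by (simp add: bounded_ops_def)

text \<open>A complex-linear operator is determined by its matrix: apply the continuous functional \<open>f \<mapsto> (T f) x\<close> to the
  expansion of \<open>f\<close> in the canonical basis.\<close>

lemma matrix_vector_has_sum:
  assumes "T \<in> bounded_ops"
  shows "((\<lambda>y. entry T x y * ell2_apply f y) has_sum ell2_apply (blinfun_apply T f) x) UNIV"
proof -
  have "bounded_linear (\<lambda>f. ell2_apply (blinfun_apply T f) x)"
    by (rule bounded_linear_compose[OF bounded_linear_ell2_apply blinfun.bounded_linear_right])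
  from has_sum_bounded_linear[OF this delta_expansion[of f]]
  show ?thesis by (simp add: bounded_opsD[OF assms] entry_eq_ell2_apply mult.commute)
qed

lemma bounded_ops_eqI:
  assumes "S \<in> bounded_ops" "T \<in> bounded_ops" and "\<And>x y. entry S x y = entry T x y"
  shows "S = T"
proof (intro blinfun_eqI ell2_eqI)
  fix f :: "'a ell2" and x
  have "((\<lambda>y. entry T x y * ell2_apply f y) has_sum ell2_apply (blinfun_apply S f) x) UNIV"
    using matrix_vector_has_sum[OF assms(1), of x f] by (simp add: assms(3))
  then show "ell2_apply (blinfun_apply S f) x = ell2_apply (blinfun_apply T f) x"
    by (rule has_sum_unique[OF _ matrix_vector_has_sum[OF assms(2)]])
qed

lemma scaleC_diff_right: "c *\<^sub>C (x - y) = c *\<^sub>C x - c *\<^sub>C (y :: 'a::complex_normed_vector)"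
  by (rule linear_diff[OF bounded_linear.linear[OF bounded_linear_scaleC]])

lemma bounded_ops_diff: "S \<in> bounded_ops \<Longrightarrow> T \<in> bounded_ops \<Longrightarrow> S - T \<in> bounded_ops"
  by (simp add: bounded_ops_def blinfun.diff_left scaleC_diff_right)

lemma closed_bounded_ops: "closed (bounded_ops :: ('a::complex_normed_vector \<Rightarrow>\<^sub>L 'a) set)"
proof -
  have eq: "(bounded_ops :: ('a \<Rightarrow>\<^sub>L 'a) set)
      = (\<Inter>c. \<Inter>x. {T. blinfun_apply T (c *\<^sub>C x) = c *\<^sub>C blinfun_apply T x})"
    by (auto simp: bounded_ops_def)
  show ?thesis
    unfolding eq
    by (intro closed_INT ballI closed_Collect_eq
        bounded_linear.continuous_on[OF bounded_linear_scaleC] continuous_intros)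
qed

lemma uniform_Roe_algebra_bounded_ops: "uniform_Roe_algebra \<subseteq> bounded_ops"
  unfolding uniform_Roe_algebra_def
  by (rule closure_minimal) (auto simp: closed_bounded_ops)

lemma sum_left_translate_le:
  assumes "finite G"
  shows "(\<Sum>x\<in>G. (cmod (ell2_apply f (s + x)))\<^sup>2) \<le> (norm (f :: 'g::group_add ell2))\<^sup>2"
proof -
  have "inj_on (\<lambda>x. s + x) G" by (auto simp: inj_on_def)
  from sum.reindex[OF this, of "\<lambda>y. (cmod (ell2_apply f y))\<^sup>2"]
  have "(\<Sum>x\<in>G. (cmod (ell2_apply f (s + x)))\<^sup>2)
      = (\<Sum>y\<in>(\<lambda>x. s + x) ` G. (cmod (ell2_apply f y))\<^sup>2)" by simp
  then show ?thesis using sum_le_norm_ell2 assms by (metis finite_imageI)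
qed

text \<open>A band matrix is a sum of one weighted translation per element of \<open>F\<close>, and each of these has
  norm at most \<open>c\<close>. This estimate makes entrywise convergence of matrices of fixed finite propagation
  a convergence in norm.\<close>

lemma norm_band_le:
  fixes R :: "'g::group_add ell2 \<Rightarrow>\<^sub>L 'g ell2" and c :: real
  assumes R: "R \<in> bounded_ops" and F: "finite F"
    and band: "\<And>x y. entry R x y \<noteq> 0 \<Longrightarrow> x - y \<in> F" and c: "\<And>x y. cmod (entry R x y) \<le> c"
  shows "norm R \<le> card F * c"
proof -
  have c0: "0 \<le> c" using c[of 0 0] norm_ge_zero order_trans by blast
  \<comment> \<open>Row \<open>x\<close> of the matrix is supported on the points \<open>- s + x\<close> with \<open>s \<in> F\<close>.\<close>
  have eq: "ell2_apply (blinfun_apply R f) x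
      = (\<Sum>s\<in>F. entry R x (- s + x) * ell2_apply f (- s + x))" for x f
  proof (rule has_sum_unique[OF matrix_vector_has_sum[OF R]])
    have inj: "inj_on (\<lambda>s. - s + x) F" by (auto simp: inj_on_def)
    have "y \<in> (\<lambda>s. - s + x) ` F" if "entry R x y \<noteq> 0" for y
      using band[OF that] by (intro image_eqI[of _ _ "x - y"]) simp
    then show "((\<lambda>y. entry R x y * ell2_apply f y) has_sum
        (\<Sum>s\<in>F. entry R x (- s + x) * ell2_apply f (- s + x))) UNIV"
      using F by (intro has_sum_finite_neutralI[of "(\<lambda>s. - s + x) ` F"])
         (auto simp: sum.reindex[OF inj])
  qed
  have row: "(cmod (ell2_apply (blinfun_apply R f) x))\<^sup>2
      \<le> card F * c\<^sup>2 * (\<Sum>s\<in>F. (cmod (ell2_apply f (- s + x)))\<^sup>2)" for x f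
  proof -
    have "cmod (ell2_apply (blinfun_apply R f) x) \<le> (\<Sum>s\<in>F. c * cmod (ell2_apply f (- s + x)))"
      unfolding eq by (rule sum_norm_le) (simp add: norm_mult mult_right_mono c)
    then have "(cmod (ell2_apply (blinfun_apply R f) x))\<^sup>2
        \<le> (\<Sum>s\<in>F. c * cmod (ell2_apply f (- s + x)))\<^sup>2" by (rule power_mono) simp
    also have "\<dots> \<le> (\<Sum>s\<in>F. (c * cmod (ell2_apply f (- s + x)))\<^sup>2) * card F"
      by (rule sum_squared_le_sum_of_squares)
    finally show ?thesis by (simp add: power_mult_distrib sum_distrib_left mult_ac)
  qed
  have "norm (blinfun_apply R f) \<le> card F * c * norm f" for f
  proof (rule norm_ell2_leI)
    show "0 \<le> card F * c * norm f" using c0 by simp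
    fix G :: "'g set" assume G: "finite G"
    have "(\<Sum>x\<in>G. (cmod (ell2_apply (blinfun_apply R f) x))\<^sup>2)
        \<le> (\<Sum>x\<in>G. card F * c\<^sup>2 * (\<Sum>s\<in>F. (cmod (ell2_apply f (- s + x)))\<^sup>2))"
      by (rule sum_mono) (rule row)
    also have "\<dots> = card F * c\<^sup>2 * (\<Sum>s\<in>F. \<Sum>x\<in>G. (cmod (ell2_apply f (- s + x)))\<^sup>2)"
      by (subst sum.swap) (simp add: sum_distrib_left)
    also have "\<dots> \<le> card F * c\<^sup>2 * (\<Sum>s\<in>F. (norm f)\<^sup>2)"
      by (intro mult_left_mono sum_mono sum_left_translate_le G) simp
    finally show "(\<Sum>x\<in>G. (cmod (ell2_apply (blinfun_apply R f) x))\<^sup>2) \<le> (card F * c * norm f)\<^sup>2"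
      by (simp add: power_mult_distrib power2_eq_square mult_ac)
  qed
  then show ?thesis using c0 by (intro norm_blinfun_bound) simp_all
qed


section \<open>Schur multipliers and the uniform Roe algebra\<close>

lemma cmod_sum_mult_power2_le:
  fixes a :: "'i \<Rightarrow> real" and b :: "'i \<Rightarrow> complex"
  shows "(cmod (\<Sum>u\<in>U. a u * b u))\<^sup>2 \<le> (\<Sum>u\<in>U. (a u)\<^sup>2) * (\<Sum>u\<in>U. (cmod (b u))\<^sup>2)"
proof -
  have "cmod (\<Sum>u\<in>U. a u * b u) \<le> (\<Sum>u\<in>U. \<bar>a u\<bar> * cmod (b u))"
    by (rule sum_norm_le) (simp add: norm_mult)
  then have "(cmod (\<Sum>u\<in>U. a u * b u))\<^sup>2 \<le> (\<Sum>u\<in>U. \<bar>a u\<bar> * cmod (b u))\<^sup>2"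
    by (rule power_mono) simp
  also have "\<dots> \<le> (\<Sum>u\<in>U. \<bar>a u\<bar>\<^sup>2) * (\<Sum>u\<in>U. (cmod (b u))\<^sup>2)"
    by (rule Cauchy_Schwarz_ineq_sum)
  finally show ?thesis by simp
qed

text \<open>The product is the sum over \<open>u\<close> of \<open>D\<^sub>u T D\<^sub>u\<close>, where \<open>D\<^sub>u\<close> is the diagonal operator with
  entries \<open>v u\<close>. This sum need not converge in norm, so it is taken coordinate by coordinate. Two
  applications of the bound on \<open>v\<close> give the norm: the vectors \<open>D\<^sub>u f\<close> have square-summable norms with total
  at most \<open>C * (norm f)\<^sup>2\<close>, which \<open>T\<close> enlarges by at most \<open>(norm T)\<^sup>2\<close>, and the Cauchy-Schwarz
  inequality in \<open>u\<close> costs another factor \<open>C\<close> in the squared norm.\<close>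

lemma schur_product_exists:
  fixes v :: "'i \<Rightarrow> 'g \<Rightarrow> real" and T :: "'g ell2 \<Rightarrow>\<^sub>L 'g ell2"
  assumes T: "T \<in> bounded_ops" and C: "0 \<le> C"
    and v: "\<And>x U. finite U \<Longrightarrow> (\<Sum>u\<in>U. (v u x)\<^sup>2) \<le> C"
  shows "\<exists>S\<in>bounded_ops. norm S \<le> C * norm T \<and>
    (\<forall>x y. entry S x y = (\<Sum>\<^sub>\<infinity>u. complex_of_real (v u x * v u y)) * entry T x y)"
proof -
  define D where "D u f = Abs_ell2 (\<lambda>x. v u x * ell2_apply f x)" for u f
  have v1: "(v u x)\<^sup>2 \<le> C" for u x using v[of "{u}" x] by simp
  have D: "ell2_apply (D u f) = (\<lambda>x. v u x * ell2_apply f x)" for u f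
    unfolding D_def
  proof (rule ell2_apply_Abs)
    fix F :: "'g set" assume F: "finite F"
    have "(\<Sum>x\<in>F. (cmod (v u x * ell2_apply f x))\<^sup>2) \<le> (\<Sum>x\<in>F. C * (cmod (ell2_apply f x))\<^sup>2)"
      by (intro sum_mono) (simp add: norm_mult power_mult_distrib mult_right_mono v1)
    also have "\<dots> \<le> C * (norm f)\<^sup>2"
      using sum_le_norm_ell2[OF F] C by (simp add: sum_distrib_left[symmetric] mult_left_mono)
    finally show "(\<Sum>x\<in>F. (cmod (v u x * ell2_apply f x))\<^sup>2) \<le> C * (norm f)\<^sup>2" .
  qed
  have D_norm: "(\<Sum>u\<in>U. (norm (D u f))\<^sup>2) \<le> C * (norm f)\<^sup>2" if U: "finite U" for U f
  proof (rule has_sum_mono)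
    show "((\<lambda>x. \<Sum>u\<in>U. (cmod (ell2_apply (D u f) x))\<^sup>2) has_sum (\<Sum>u\<in>U. (norm (D u f))\<^sup>2)) UNIV"
      by (intro has_sum_finite_sum norm_ell2_has_sum)
    show "((\<lambda>x. C * (cmod (ell2_apply f x))\<^sup>2) has_sum C * (norm f)\<^sup>2) UNIV"
      by (intro has_sum_cmult_right norm_ell2_has_sum)
    show "(\<Sum>u\<in>U. (cmod (ell2_apply (D u f) x))\<^sup>2) \<le> C * (cmod (ell2_apply f x))\<^sup>2" for x
      using mult_right_mono[OF v[OF U, of x], of "(cmod (ell2_apply f x))\<^sup>2"]
      by (simp add: D norm_mult power_mult_distrib sum_distrib_right)
  qed
  define Q where "Q f x u = ell2_apply (blinfun_apply T (D u f)) x" for f x u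
  define B where "B f = (norm T)\<^sup>2 * (C * (norm f)\<^sup>2)" for f :: "'g ell2"
  have Q_sum: "(\<Sum>x\<in>G. \<Sum>u\<in>U. (cmod (Q f x u))\<^sup>2) \<le> B f" if "finite U" "finite G" for U G f
  proof -
    have "(\<Sum>x\<in>G. \<Sum>u\<in>U. (cmod (Q f x u))\<^sup>2) = (\<Sum>u\<in>U. \<Sum>x\<in>G. (cmod (Q f x u))\<^sup>2)"
      by (rule sum.swap)
    also have "\<dots> \<le> (\<Sum>u\<in>U. (norm T * norm (D u f))\<^sup>2)"
      unfolding Q_def
      by (intro sum_mono order_trans[OF sum_le_norm_ell2[OF that(2)]] power_mono norm_blinfun) simp
    also have "\<dots> = (norm T)\<^sup>2 * (\<Sum>u\<in>U. (norm (D u f))\<^sup>2)"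
      by (simp add: power_mult_distrib sum_distrib_left)
    also have "\<dots> \<le> B f"
      unfolding B_def by (intro mult_left_mono D_norm that) simp
    finally show ?thesis .
  qed
  have summ: "(\<lambda>u. v u x * Q f x u) summable_on UNIV" for f x
  proof (rule abs_summable_summable, rule nonneg_summable_bounded(1))
    fix U :: "'i set" assume U: "finite U"
    have "(\<Sum>u\<in>U. cmod (v u x * Q f x u)) \<le> (\<Sum>u\<in>U. (v u x)\<^sup>2 + (cmod (Q f x u))\<^sup>2)"
    proof (rule sum_mono)
      fix u
      have "2 * (\<bar>v u x\<bar> * cmod (Q f x u)) \<le> (v u x)\<^sup>2 + (cmod (Q f x u))\<^sup>2"
        using sum_squares_bound[of "\<bar>v u x\<bar>" "cmod (Q f x u)"] by (simp add: mult.assoc)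
      moreover have "0 \<le> \<bar>v u x\<bar> * cmod (Q f x u)" by simp
      ultimately show "cmod (v u x * Q f x u) \<le> (v u x)\<^sup>2 + (cmod (Q f x u))\<^sup>2"
        unfolding norm_mult norm_of_real by linarith
    qed
    also have "\<dots> \<le> C + B f"
      using v[OF U, of x] Q_sum[OF U, of "{x}" f] by (simp add: sum.distrib)
    finally show "(\<Sum>u\<in>U. cmod (v u x * Q f x u)) \<le> C + B f" .
  qed simp
  define s where "s f x = (\<Sum>\<^sub>\<infinity>u. v u x * Q f x u)" for f x
  have s_bound: "(\<Sum>x\<in>G. (cmod (s f x))\<^sup>2) \<le> (C * norm T * norm f)\<^sup>2" if G: "finite G" for G f
  proof (rule tendsto_upperbound)
    show "((\<lambda>U. \<Sum>x\<in>G. (cmod (\<Sum>u\<in>U. v u x * Q f x u))\<^sup>2) \<longlongrightarrow> (\<Sum>x\<in>G. (cmod (s f x))\<^sup>2))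
        (finite_subsets_at_top UNIV)"
      unfolding s_def by (intro tendsto_intros infsum_tendsto summ)
    have "(\<Sum>x\<in>G. (cmod (\<Sum>u\<in>U. v u x * Q f x u))\<^sup>2) \<le> (C * norm T * norm f)\<^sup>2"
      if U: "finite U" for U
    proof -
      have "(\<Sum>x\<in>G. (cmod (\<Sum>u\<in>U. v u x * Q f x u))\<^sup>2) \<le> (\<Sum>x\<in>G. C * (\<Sum>u\<in>U. (cmod (Q f x u))\<^sup>2))"
        by (intro sum_mono order_trans[OF cmod_sum_mult_power2_le] mult_right_mono v U sum_nonneg) simp
      also have "\<dots> \<le> C * B f"
        unfolding sum_distrib_left[symmetric] by (intro mult_left_mono Q_sum U G C)
      finally show ?thesis by (simp add: B_def power_mult_distrib power2_eq_square mult_ac)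
    qed
    then show "\<forall>\<^sub>F U in finite_subsets_at_top UNIV.
        (\<Sum>x\<in>G. (cmod (\<Sum>u\<in>U. v u x * Q f x u))\<^sup>2) \<le> (C * norm T * norm f)\<^sup>2"
      by (auto intro: eventually_finite_subsets_at_top_weakI)
  qed simp
  define S where "S f = Abs_ell2 (s f)" for f
  have S: "ell2_apply (S f) = s f" for f
    unfolding S_def by (rule ell2_apply_Abs) (rule s_bound)
  have D_add: "D u (f + g) = D u f + D u g" for u f g
    by (rule ell2_eqI) (simp add: D distrib_left)
  have D_scale: "D u (c *\<^sub>C f) = c *\<^sub>C D u f" for u c f
    by (rule ell2_eqI) (simp add: D)
  have S_add: "S (f + g) = S f + S g" for f g
  proof (rule ell2_eqI)
    fix x
    have "s (f + g) x = (\<Sum>\<^sub>\<infinity>u. v u x * Q f x u + v u x * Q g x u)"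
      by (simp add: s_def Q_def D_add blinfun.add_right distrib_left)
    then show "ell2_apply (S (f + g)) x = ell2_apply (S f + S g) x"
      by (simp add: S s_def infsum_add[OF summ summ])
  qed
  have S_scale: "S (c *\<^sub>C f) = c *\<^sub>C S f" for c f
  proof (rule ell2_eqI)
    fix x
    have "s (c *\<^sub>C f) x = (\<Sum>\<^sub>\<infinity>u. c * (v u x * Q f x u))"
      by (simp add: s_def Q_def D_scale bounded_opsD[OF T] mult_ac)
    then show "ell2_apply (S (c *\<^sub>C f)) x = ell2_apply (c *\<^sub>C S f) x"
      by (simp add: S s_def infsum_cmult_right')
  qed
  have S_norm: "norm (S f) \<le> C * norm T * norm f" for f
    by (rule norm_ell2_leI) (use C s_bound in \<open>simp_all add: S\<close>)
  have "bounded_linear S"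
    by (rule bounded_linear_intro[where K = "C * norm T"])
       (use S_norm in \<open>simp_all add: S_add S_scale scaleR_scaleC mult_ac\<close>)
  then have apply_S: "blinfun_apply (Blinfun S) = S" by (rule bounded_linear_Blinfun_apply)
  show ?thesis
  proof (intro bexI[of _ "Blinfun S"] conjI allI)
    show "Blinfun S \<in> bounded_ops" by (simp add: bounded_ops_def apply_S S_scale)
    show "norm (Blinfun S) \<le> C * norm T"
      by (rule norm_blinfun_bound) (use C S_norm in \<open>simp_all add: apply_S\<close>)
    fix x y
    have "D u (delta y) = complex_of_real (v u y) *\<^sub>C delta y" for u
      by (rule ell2_eqI) (simp add: D)
    then have "s (delta y) x = (\<Sum>\<^sub>\<infinity>u. complex_of_real (v u x * v u y) * entry T x y)"
      by (simp add: s_def Q_def bounded_opsD[OF T] entry_eq_ell2_apply mult_ac)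
    then show "entry (Blinfun S) x y
        = (\<Sum>\<^sub>\<infinity>u. complex_of_real (v u x * v u y)) * entry T x y"
      by (simp add: entry_eq_ell2_apply[of "Blinfun S"] apply_S S infsum_cmult_left')
  qed
qed

text \<open>The symbol defines a Schur multiplier of norm at most \<open>C\<close> on all bounded operators, not just on the
  uniform Roe algebra. The existence form is what makes the description operator in
  \<^const>\<open>schur_multiplier\<close> usable.\<close>

definition bounded_schur :: "real \<Rightarrow> ('g::group_add \<Rightarrow> complex) \<Rightarrow> bool" where
  "bounded_schur C \<phi> \<longleftrightarrow> 0 \<le> C \<and> (\<forall>T\<in>bounded_ops. \<exists>S\<in>bounded_ops.
     norm S \<le> C * norm T \<and> (\<forall>x y. entry S x y = \<phi> (x - y) * entry T x y))"

lemma
  assumes "bounded_schur C \<phi>" and "T \<in> bounded_ops"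
  shows schur_multiplier_bounded_ops: "schur_multiplier \<phi> T \<in> bounded_ops"
    and entry_schur_multiplier: "entry (schur_multiplier \<phi> T) x y = \<phi> (x - y) * entry T x y"
    and norm_schur_multiplier_le: "norm (schur_multiplier \<phi> T) \<le> C * norm T"
proof -
  obtain S where S: "S \<in> bounded_ops" "norm S \<le> C * norm T"
      "\<forall>x y. entry S x y = \<phi> (x - y) * entry T x y"
    using assms unfolding bounded_schur_def by blast
  have "schur_multiplier \<phi> T = S"
    unfolding schur_multiplier_def
    by (rule the_equality) (use S in \<open>auto intro!: bounded_ops_eqI\<close>)
  with S show "schur_multiplier \<phi> T \<in> bounded_ops"
      "entry (schur_multiplier \<phi> T) x y = \<phi> (x - y) * entry T x y"
      "norm (schur_multiplier \<phi> T) \<le> C * norm T" by auto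
qed

lemma op_of_roe_bounded_ops [simp]: "op_of_roe T \<in> bounded_ops"
  using op_of_roe[of T] uniform_Roe_algebra_bounded_ops by blast

text \<open>A multiplier does not enlarge the propagation, and it is norm continuous.\<close>

lemma schur_multiplier_uniform_Roe_algebra:
  assumes C: "bounded_schur C \<phi>" and T: "T \<in> uniform_Roe_algebra"
  shows "schur_multiplier \<phi> T \<in> uniform_Roe_algebra"
proof -
  have Tb: "T \<in> bounded_ops" using T uniform_Roe_algebra_bounded_ops by blast
  obtain t where t: "\<And>n. t n \<in> bounded_ops" "\<And>n. finite_propagation (t n)" "t \<longlonglongrightarrow> T"
    using T unfolding uniform_Roe_algebra_def closure_sequential mem_Collect_eq by metis
  have bound: "norm (schur_multiplier \<phi> (t n) - schur_multiplier \<phi> T) \<le> C * norm (t n - T)" for n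
  proof -
    have "schur_multiplier \<phi> (t n) - schur_multiplier \<phi> T = schur_multiplier \<phi> (t n - T)"
      by (rule bounded_ops_eqI)
         (simp_all add: bounded_ops_diff schur_multiplier_bounded_ops[OF C] t Tb entry_diff
           entry_schur_multiplier[OF C] right_diff_distrib)
    then show ?thesis by (simp add: norm_schur_multiplier_le[OF C] bounded_ops_diff t Tb)
  qed
  have "(\<lambda>n. C * norm (t n - T)) \<longlonglongrightarrow> 0"
    using tendsto_mult_left[OF tendsto_norm[OF LIM_zero[OF t(3)]], of C] by simp
  then have "(\<lambda>n. schur_multiplier \<phi> (t n) - schur_multiplier \<phi> T) \<longlonglongrightarrow> 0"
    by (rule Lim_null_comparison[OF always_eventually[OF allI[OF bound]]])
  then have "(\<lambda>n. schur_multiplier \<phi> (t n)) \<longlonglongrightarrow> schur_multiplier \<phi> T" by (rule LIM_zero_cancel)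
  moreover have "finite_propagation (schur_multiplier \<phi> (t n))" for n
    using t(2)[of n] unfolding finite_propagation_def
    by (metis entry_schur_multiplier[OF C t(1)] mult_zero_right)
  ultimately show ?thesis
    unfolding uniform_Roe_algebra_def closure_sequential
    by (intro CollectI exI[of _ "\<lambda>n. schur_multiplier \<phi> (t n)"])
       (simp add: schur_multiplier_bounded_ops[OF C t(1)])
qed

lemma op_of_roe_simps [simp]:
  "op_of_roe (S + T) = op_of_roe S + op_of_roe T" "op_of_roe (S - T) = op_of_roe S - op_of_roe T"
  "op_of_roe 0 = 0" "op_of_roe (c *\<^sub>C T) = c *\<^sub>C op_of_roe T" "op_of_roe (r *\<^sub>R T) = r *\<^sub>R op_of_roe T"
  by (simp_all add: plus_roe.rep_eq minus_roe.rep_eq zero_roe.rep_eq scaleC_roe.rep_eq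
      scaleR_roe.rep_eq)

lemma op_of_roe_sum [simp]: "op_of_roe (\<Sum>i\<in>I. T i) = (\<Sum>i\<in>I. op_of_roe (T i))"
  by (induction I rule: infinite_finite_induct) auto

lemma roe_eqI:
  assumes "\<And>x y. entry (op_of_roe S) x y = entry (op_of_roe T) x y"
  shows "S = T"
  using bounded_ops_eqI[OF op_of_roe_bounded_ops op_of_roe_bounded_ops assms]
  by (simp add: op_of_roe_inject)

lemma
  assumes C: "bounded_schur C \<phi>"
  shows entry_M_op: "entry (op_of_roe (blinfun_apply (M_op \<phi>) T)) x y
      = \<phi> (x - y) * entry (op_of_roe T) x y"
    and norm_M_op_le: "norm (M_op \<phi>) \<le> C"
    and M_op_bounded_ops: "M_op \<phi> \<in> bounded_ops"
proof -
  define m where "m T = Abs_roe (schur_multiplier \<phi> (op_of_roe T))" for T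
  have m: "op_of_roe (m T) = schur_multiplier \<phi> (op_of_roe T)" for T
    unfolding m_def by (rule Abs_roe_inverse[OF schur_multiplier_uniform_Roe_algebra[OF C op_of_roe]])
  have e: "entry (op_of_roe (m T)) x y = \<phi> (x - y) * entry (op_of_roe T) x y" for T x y
    by (simp add: m entry_schur_multiplier[OF C])
  have m_norm: "norm (m T) \<le> C * norm T" for T
    by (simp add: norm_roe.rep_eq m norm_schur_multiplier_le[OF C])
  have m_add: "m (S + T) = m S + m T" and m_scale: "m (c *\<^sub>C T) = c *\<^sub>C m T" for S T c
    by (rule roe_eqI; simp add: e entry_add entry_scaleC distrib_left)+
  have "bounded_linear m"
    by (rule bounded_linear_intro[where K=C])
       (use m_norm in \<open>simp_all add: m_add m_scale scaleR_scaleC mult.commute\<close>)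
  then have *: "blinfun_apply (M_op \<phi>) = m"
    unfolding M_op_def m_def by (rule bounded_linear_Blinfun_apply)
  show "entry (op_of_roe (blinfun_apply (M_op \<phi>) T)) x y = \<phi> (x - y) * entry (op_of_roe T) x y"
    by (simp add: * e)
  show "norm (M_op \<phi>) \<le> C"
    by (rule norm_blinfun_bound) (use C m_norm in \<open>auto simp: * bounded_schur_def\<close>)
  show "M_op \<phi> \<in> bounded_ops" by (simp add: bounded_ops_def * m_scale)
qed

lemma M_op_eqI:
  assumes "bounded_schur C \<phi>"
    and "\<And>T x y. entry (op_of_roe (blinfun_apply N T)) x y = \<phi> (x - y) * entry (op_of_roe T) x y"
  shows "N = M_op \<phi>"
  by (intro blinfun_eqI roe_eqI) (simp add: assms(2) entry_M_op[OF assms(1)])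

lemma entry_sum: "entry (\<Sum>i\<in>I. T i) x y = (\<Sum>i\<in>I. entry (T i) x y)"
  by (induction I rule: infinite_finite_induct)
     (auto simp: entry_add entry_eq_ell2_apply[of 0])

text \<open>The difference between \<open>M_op \<phi>\<close> and a partial sum is again a multiplier, so the rate of
  convergence can be read off from the symbols of the remainders.\<close>

lemma M_op_has_sum:
  assumes \<phi>: "bounded_schur C \<phi>" and \<psi>: "\<And>i. i \<in> I \<Longrightarrow> bounded_schur (D i) (\<psi> i)"
    and r: "\<And>F. finite F \<Longrightarrow> F \<subseteq> I \<Longrightarrow> bounded_schur (r F) (\<lambda>s. \<phi> s - (\<Sum>i\<in>F. \<psi> i s))"
    and r0: "(r \<longlongrightarrow> 0) (finite_subsets_at_top I)"
  shows "((\<lambda>i. M_op (\<psi> i)) has_sum M_op \<phi>) I"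
proof -
  have bound: "norm ((\<Sum>i\<in>F. M_op (\<psi> i)) - M_op \<phi>) \<le> r F" if F: "finite F" "F \<subseteq> I" for F
  proof -
    have "M_op \<phi> - (\<Sum>i\<in>F. M_op (\<psi> i)) = M_op (\<lambda>s. \<phi> s - (\<Sum>i\<in>F. \<psi> i s))"
    proof (rule M_op_eqI[OF r[OF F]])
      fix T x y
      have "(\<Sum>i\<in>F. entry (op_of_roe (blinfun_apply (M_op (\<psi> i)) T)) x y)
          = (\<Sum>i\<in>F. \<psi> i (x - y) * entry (op_of_roe T) x y)"
        using F by (intro sum.cong refl entry_M_op[OF \<psi>]) auto
      then show "entry (op_of_roe (blinfun_apply (M_op \<phi> - (\<Sum>i\<in>F. M_op (\<psi> i))) T)) x y
          = (\<phi> (x - y) - (\<Sum>i\<in>F. \<psi> i (x - y))) * entry (op_of_roe T) x y"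
        by (simp add: blinfun.diff_left blinfun.sum_left entry_diff entry_sum entry_M_op[OF \<phi>]
            left_diff_distrib sum_distrib_right)
    qed
    then show ?thesis using norm_M_op_le[OF r[OF F]] by (simp add: norm_minus_commute)
  qed
  have "((\<lambda>F. (\<Sum>i\<in>F. M_op (\<psi> i)) - M_op \<phi>) \<longlongrightarrow> 0) (finite_subsets_at_top I)"
    by (rule Lim_null_comparison[OF _ r0])
       (use bound in \<open>auto intro: eventually_finite_subsets_at_top_weakI\<close>)
  then show ?thesis unfolding has_sum_def by (rule LIM_zero_cancel)
qed

lemma finite_propagation_uniform_Roe_algebra:
  "T \<in> bounded_ops \<Longrightarrow> finite_propagation T \<Longrightarrow> T \<in> uniform_Roe_algebra"
  unfolding uniform_Roe_algebra_def by (intro subsetD[OF closure_subset]) simp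

lemma finite_propagation_approx:
  assumes "0 < e"
  obtains T' where "finite_propagation (op_of_roe T')" and "norm (T - T') < e"
proof -
  obtain U where U: "U \<in> bounded_ops" "finite_propagation U" "dist U (op_of_roe T) < e"
    using op_of_roe[of T] assms unfolding uniform_Roe_algebra_def closure_approachable by blast
  then have "op_of_roe (Abs_roe U) = U"
    by (intro Abs_roe_inverse finite_propagation_uniform_Roe_algebra)
  with U show ?thesis
    by (intro that[of "Abs_roe U"]) (simp_all add: norm_roe.rep_eq dist_norm norm_minus_commute)
qed

text \<open>By the uniform bound it suffices to test on operators of finite propagation. There
  the difference of the two images is a band matrix whose entries are controlled by the finitely many
  numbers \<open>\<phi>n n s - \<phi> s\<close>, with \<open>s\<close> in the propagation set.\<close>

lemma M_op_tendsto:
  assumes \<phi>n: "\<And>n. bounded_schur C (\<phi>n n)" and \<phi>: "bounded_schur C \<phi>"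
    and lim: "\<And>s. (\<lambda>n. \<phi>n n s) \<longlonglongrightarrow> \<phi> s"
  shows "(\<lambda>n. blinfun_apply (M_op (\<phi>n n)) T) \<longlonglongrightarrow> blinfun_apply (M_op \<phi>) T"
proof (rule LIMSEQ_I)
  fix e :: real assume e: "0 < e"
  have C: "0 \<le> C" using \<phi> by (simp add: bounded_schur_def)
  define d where "d = e / (4 * (C + 1))"
  have d: "0 < d" "2 * (C * d) < e / 2 + e / 4"
    using e C by (auto simp: d_def field_simps intro: add_pos_nonneg)
  obtain T' where T': "finite_propagation (op_of_roe T')" "norm (T - T') < d"
    using finite_propagation_approx[OF d(1)] .
  then obtain F where F: "finite F" "\<And>x y. entry (op_of_roe T') x y \<noteq> 0 \<Longrightarrow> x - y \<in> F"
    unfolding finite_propagation_def by metis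
  define b where "b n = card F * ((\<Sum>s\<in>F. cmod (\<phi>n n s - \<phi> s)) * norm T')" for n
  have "(\<lambda>n. b n) \<longlonglongrightarrow> card F * ((\<Sum>s\<in>F. cmod (\<phi> s - \<phi> s)) * norm T')"
    unfolding b_def by (intro tendsto_intros lim)
  then have "b \<longlonglongrightarrow> 0" by simp
  then obtain n0 where n0: "\<And>n. n0 \<le> n \<Longrightarrow> \<bar>b n\<bar> < e / 4"
    using e by (metis LIMSEQ_D[of b 0 "e/4"] diff_zero real_norm_def zero_less_divide_iff zero_less_numeral)
  have "norm (blinfun_apply (M_op (\<phi>n n)) T - blinfun_apply (M_op \<phi>) T) < e" if n: "n0 \<le> n" for n
  proof -
    let ?M = "M_op (\<phi>n n)" and ?N = "M_op \<phi>"
    have split: "blinfun_apply ?M T - blinfun_apply ?N T = blinfun_apply ?M (T - T')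
        - blinfun_apply ?N (T - T') + (blinfun_apply ?M T' - blinfun_apply ?N T')"
      by (simp add: blinfun.diff_right)
    have small: "norm (blinfun_apply (M_op \<psi>) (T - T')) \<le> C * d" if "bounded_schur C \<psi>" for \<psi>
      using norm_blinfun[of "M_op \<psi>" "T - T'"] norm_M_op_le[OF that] T'(2) C
        mult_mono[of "norm (M_op \<psi>)" C "norm (T - T')" d] by simp
    have "norm (blinfun_apply ?M T' - blinfun_apply ?N T') \<le> b n"
      unfolding norm_roe.rep_eq b_def
    proof (rule norm_band_le[OF op_of_roe_bounded_ops F(1)])
      fix x y
      have eq: "entry (op_of_roe (blinfun_apply ?M T' - blinfun_apply ?N T')) x y
          = (\<phi>n n (x - y) - \<phi> (x - y)) * entry (op_of_roe T') x y"
        by (simp add: entry_diff entry_M_op[OF \<phi>n] entry_M_op[OF \<phi>] left_diff_distrib)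
      then show "x - y \<in> F"
        if "entry (op_of_roe (blinfun_apply ?M T' - blinfun_apply ?N T')) x y \<noteq> 0"
        using that F(2) by auto
      have pos: "0 \<le> (\<Sum>s\<in>F. cmod (\<phi>n n s - \<phi> s))" by (simp add: sum_nonneg)
      show "cmod (entry (op_of_roe (blinfun_apply ?M T' - blinfun_apply ?N T')) x y)
          \<le> (\<Sum>s\<in>F. cmod (\<phi>n n s - \<phi> s)) * norm (op_of_roe T')"
      proof (cases "entry (op_of_roe T') x y = 0")
        case True then show ?thesis by (simp add: eq pos del: op_of_roe_simps)
      next
        case False
        then have "cmod (\<phi>n n (x - y) - \<phi> (x - y)) \<le> (\<Sum>s\<in>F. cmod (\<phi>n n s - \<phi> s))"
          using F by (intro member_le_sum) auto
        then show ?thesis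
          unfolding eq norm_mult by (intro mult_mono norm_entry_le pos) auto
      qed
    qed
    moreover have "norm (blinfun_apply ?M T - blinfun_apply ?N T)
        \<le> norm (blinfun_apply ?M (T - T')) + norm (blinfun_apply ?N (T - T'))
          + norm (blinfun_apply ?M T' - blinfun_apply ?N T')"
      unfolding split by (intro norm_triangle_le add_right_mono norm_triangle_ineq4)
    ultimately show ?thesis
      using small[OF \<phi>n[of n]] small[OF \<phi>] n0[OF n] d(2) by linarith
  qed
  then show "\<exists>n0. \<forall>n\<ge>n0. norm (blinfun_apply (M_op (\<phi>n n)) T - blinfun_apply (M_op \<phi>) T) < e"
    by blast
qed

section \<open>The strong operator topology\<close>

lemma limitin_SOT:
  assumes N: "\<And>n. N n \<in> bounded_ops" and L: "L \<in> bounded_ops"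
    and lim: "\<And>T. (\<lambda>n. blinfun_apply (N n) T) \<longlonglongrightarrow> blinfun_apply L T"
  shows "limitin SOT N L sequentially"
proof -
  have "limitin strong_operator_topology N L sequentially"
    unfolding limitin_def strong_operator_topology_topspace
  proof (intro conjI allI impI UNIV_I)
    fix U assume U: "openin strong_operator_topology U \<and> L \<in> U"
    then obtain V where V: "open V" "U = blinfun_apply -` V \<inter> UNIV"
      unfolding strong_operator_topology_def openin_pullback_topology by auto
    have "limitin (product_topology (\<lambda>_. euclidean) UNIV)
        (\<lambda>n. blinfun_apply (N n)) (blinfun_apply L) sequentially"
      unfolding limitin_componentwise using lim by auto
    then have "(\<lambda>n. blinfun_apply (N n)) \<longlonglongrightarrow> blinfun_apply L"
      by (simp add: euclidean_product_topology)
    with U V show "\<forall>\<^sub>F n in sequentially. N n \<in> U"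
      by (auto dest: topological_tendstoD)
  qed
  with N L show ?thesis unfolding SOT_def limitin_subtopology by simp
qed

lemma topspace_SOT: "topspace SOT = bounded_ops"
  by (simp add: SOT_def strong_operator_topology_topspace)

lemma limitin_imp_in_closure_of:
  assumes "limitin X N L sequentially" and "\<And>n. N n \<in> S"
  shows "L \<in> X closure_of S"
  unfolding in_closure_of
proof (intro conjI allI impI)
  show "L \<in> topspace X" using assms(1) by (simp add: limitin_def)
  fix U assume "L \<in> U \<and> openin X U"
  then have "\<forall>\<^sub>F n in sequentially. N n \<in> U" using assms(1) by (simp add: limitin_def)
  then have "\<exists>n. N n \<in> U" by (auto simp: eventually_sequentially)
  then show "\<exists>y. y \<in> S \<and> y \<in> U" using assms(2) by blast
qed

text \<open>The strong operator topology is not first countable in general, but a point of the closure can be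
  approximated by a sequence when only countably many test vectors are prescribed.\<close>

lemma SOT_closure_sequence:
  fixes \<tau> :: "nat \<Rightarrow> 'a::complex_normed_vector"
  assumes M: "M \<in> SOT closure_of S"
  obtains N where "\<And>n. N n \<in> S"
    and "\<And>k. (\<lambda>n. blinfun_apply (N n) (\<tau> k)) \<longlonglongrightarrow> blinfun_apply M (\<tau> k)"
proof -
  have "\<exists>N\<in>S. \<forall>k\<in>{..n}. dist (blinfun_apply M (\<tau> k)) (blinfun_apply N (\<tau> k)) < 1 / Suc n" for n
  proof -
    let ?U = "{N. \<forall>k\<in>{..n}. blinfun_apply N (\<tau> k) \<in> ball (blinfun_apply M (\<tau> k)) (1 / Suc n)}"
    have "openin strong_operator_topology ?U"
      by (rule strong_operator_topology_basis) auto
    then have "openin SOT (?U \<inter> bounded_ops)" unfolding SOT_def by (rule openin_subtopology_Int)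
    moreover have "M \<in> ?U \<inter> bounded_ops"
      using M by (auto simp: in_closure_of topspace_SOT)
    moreover have "\<forall>V. M \<in> V \<and> openin SOT V \<longrightarrow> (\<exists>N. N \<in> S \<and> N \<in> V)"
      using M by (simp add: in_closure_of)
    ultimately have "\<exists>N. N \<in> S \<and> N \<in> ?U \<inter> bounded_ops" by (meson conjI)
    then show ?thesis by auto
  qed
  then obtain N where N: "\<And>n. N n \<in> S"
      "\<And>n k. k \<le> n \<Longrightarrow> dist (blinfun_apply M (\<tau> k)) (blinfun_apply (N n) (\<tau> k)) < 1 / Suc n"
    by (metis atMost_iff)
  have "(\<lambda>n. blinfun_apply (N n) (\<tau> k)) \<longlonglongrightarrow> blinfun_apply M (\<tau> k)" for k
  proof (rule metric_LIMSEQ_I)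
    fix e :: real assume "0 < e"
    then obtain n0 where n0: "1 / Suc n0 < e" using nat_approx_posE by blast
    have "dist (blinfun_apply (N n) (\<tau> k)) (blinfun_apply M (\<tau> k)) < e" if "max k n0 \<le> n" for n
    proof -
      have "1 / Suc n \<le> 1 / Suc n0" using that by (intro divide_left_mono) auto
      with N(2)[of k n] that n0 show ?thesis by (simp add: dist_commute)
    qed
    then show "\<exists>n0. \<forall>n\<ge>n0. dist (blinfun_apply (N n) (\<tau> k)) (blinfun_apply M (\<tau> k)) < e" by blast
  qed
  with N(1) show ?thesis using that by blast
qed

text \<open>The image of the translation by \<open>s\<close> under a multiplier has the value of the symbol at \<open>s\<close> as
  its entries on the band \<open>x - y = s\<close>, so these operators recover the symbol.\<close>

lemma translation_operator:
  fixes s :: "'g::group_add"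
  obtains L :: "'g roe" where "\<And>x y. entry (op_of_roe L) x y = (if x - y = s then 1 else 0)"
proof -
  define l where "l f = Abs_ell2 (\<lambda>x. ell2_apply f (- s + x))" for f :: "'g ell2"
  have l: "ell2_apply (l f) = (\<lambda>x. ell2_apply f (- s + x))" for f
    unfolding l_def by (rule ell2_apply_Abs) (rule sum_left_translate_le)
  have l_add: "l (f + g) = l f + l g" and l_scale: "l (c *\<^sub>C f) = c *\<^sub>C l f" for f g c
    by (rule ell2_eqI; simp add: l)+
  have "norm (l f) \<le> norm f" for f
    by (rule norm_ell2_leI) (use sum_left_translate_le in \<open>simp_all add: l\<close>)
  then have "bounded_linear l"
    by (intro bounded_linear_intro[where K=1]) (simp_all add: l_add l_scale scaleR_scaleC)
  then have apply_l: "blinfun_apply (Blinfun l) = l" by (rule bounded_linear_Blinfun_apply)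
  have e: "entry (Blinfun l) x y = (if x - y = s then 1 else 0)" for x y
  proof -
    have "- s + x = y \<longleftrightarrow> x - y = s"
      by (metis add.assoc add.right_inverse add_0 add_uminus_conv_diff diff_add_cancel minus_add_cancel)
    then show ?thesis by (simp add: entry_eq_ell2_apply apply_l l)
  qed
  have "Blinfun l \<in> bounded_ops" by (simp add: bounded_ops_def apply_l l_scale)
  moreover have "finite_propagation (Blinfun l)"
    unfolding finite_propagation_def by (intro exI[of _ "{s}"]) (simp add: e)
  ultimately have "Blinfun l \<in> uniform_Roe_algebra"
    by (rule finite_propagation_uniform_Roe_algebra)
  then show ?thesis by (intro that[of "Abs_roe (Blinfun l)"]) (simp add: Abs_roe_inverse e)
qed

section \<open>Nonnegative functions of bounded \<open>p\<close>-mass\<close>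

text \<open>Equivalently, the \<open>p\<close>-th powers are summable with sum at most one. Bounding the finite sums keeps
  the notion stable under pointwise limits and under restriction along injections without any
  side conditions on summability.\<close>

definition profile :: "real \<Rightarrow> ('z \<Rightarrow> real) \<Rightarrow> bool" where
  "profile p A \<longleftrightarrow> (\<forall>z. 0 \<le> A z) \<and> (\<forall>F. finite F \<longrightarrow> (\<Sum>z\<in>F. A z powr p) \<le> 1)"

lemma profile_nonneg: "profile p A \<Longrightarrow> 0 \<le> A z"
  by (simp add: profile_def)

lemma profile_sum_le: "profile p A \<Longrightarrow> finite F \<Longrightarrow> (\<Sum>z\<in>F. A z powr p) \<le> 1"
  by (simp add: profile_def)

lemma profile_comp_inj:
  assumes "profile p A" "inj h"
  shows "profile p (\<lambda>x. A (h x))"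
  unfolding profile_def
proof (intro conjI allI impI)
  show "0 \<le> A (h x)" for x by (rule profile_nonneg[OF assms(1)])
  fix F :: "'b set" assume "finite F"
  then show "(\<Sum>x\<in>F. A (h x) powr p) \<le> 1"
    using profile_sum_le[OF assms(1), of "h ` F"] inj_on_subset[OF assms(2)]
    by (simp add: sum.reindex)
qed

lemma profile_le_1:
  assumes "profile p A" "0 < p"
  shows "A z \<le> 1"
proof (rule ccontr)
  assume "\<not> A z \<le> 1"
  then have "1 < A z powr p" using assms(2) by (intro gr_one_powr) auto
  then show False using profile_sum_le[OF assms(1), of "{z}"] by simp
qed

lemma profile_sum_squares_le:
  assumes A: "profile p A" and p: "1 \<le> p" "p < 2" and F: "finite F"
  shows "(\<Sum>z\<in>F. (A z)\<^sup>2) \<le> (\<Sum>z\<in>F. A z powr p)"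
proof (rule sum_mono)
  fix z
  have "A z powr 2 \<le> A z powr p"
    using p profile_le_1[OF A] profile_nonneg[OF A] by (intro powr_mono') auto
  then show "(A z)\<^sup>2 \<le> A z powr p"
    using profile_nonneg[OF A, of z] by (simp add: powr_numeral)
qed

text \<open>Split \<open>x * y = x powr (2 - p) * (x powr (p - 1) * y)\<close> and bound the second factor by
  \<open>max x y powr p\<close>. The point is that for \<open>p < 2\<close> a small value contributes little to a product even
  though its partner may be large.\<close>

lemma mult_le_powr:
  fixes x y \<eta> p :: real
  assumes x: "0 \<le> x" "x \<le> \<eta>" and y: "0 \<le> y" and p: "1 \<le> p" "p < 2"
  shows "x * y \<le> \<eta> powr (2 - p) * (x powr p + y powr p)"
proof (cases "x = 0 \<or> y = 0")
  case True then show ?thesis by auto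
next
  case False
  then have pos: "0 < x" "0 < y" using x y by auto
  define m where "m = max x y"
  have m: "0 < m" "x \<le> m" "y \<le> m" using pos by (auto simp: m_def)
  have "x * y = x powr (2 - p) * (x powr (p - 1) * y)"
    using pos by (simp add: powr_add[symmetric] mult.assoc[symmetric])
  also have "\<dots> \<le> \<eta> powr (2 - p) * (x powr p + y powr p)"
  proof (rule mult_mono)
    show "x powr (2 - p) \<le> \<eta> powr (2 - p)" using x p by (intro powr_mono2) auto
    have "x powr (p - 1) * y \<le> m powr (p - 1) * m"
      using m pos p by (intro mult_mono powr_mono2) auto
    also have "\<dots> = m powr p" using m powr_add[of m "p - 1" 1] by simp
    also have "\<dots> \<le> x powr p + y powr p" by (simp add: m_def max_def)
    finally show "x powr (p - 1) * y \<le> x powr p + y powr p" .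
  qed (use pos in auto)
  finally show ?thesis .
qed

text \<open>The estimate behind both halves of the theorem: a part of a function with small values is invisible
  to autocorrelations, however much \<open>p\<close>-mass it carries (up to one).\<close>

lemma sum_mult_small_le:
  fixes x y :: "'z \<Rightarrow> real"
  assumes p: "1 \<le> p" "p < 2"
    and x: "\<And>z. z \<in> F \<Longrightarrow> 0 \<le> x z" "\<And>z. z \<in> F \<Longrightarrow> x z \<le> \<eta>"
    and y: "\<And>z. z \<in> F \<Longrightarrow> 0 \<le> y z"
    and sums: "(\<Sum>z\<in>F. x z powr p) \<le> 1" "(\<Sum>z\<in>F. y z powr p) \<le> 1"
  shows "(\<Sum>z\<in>F. x z * y z) \<le> 2 * \<eta> powr (2 - p)"
proof -
  have "(\<Sum>z\<in>F. x z * y z) \<le> (\<Sum>z\<in>F. \<eta> powr (2 - p) * (x z powr p + y z powr p))"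
    by (intro sum_mono mult_le_powr x y p)
  also have "\<dots> = \<eta> powr (2 - p) * ((\<Sum>z\<in>F. x z powr p) + (\<Sum>z\<in>F. y z powr p))"
    by (simp add: sum_distrib_left[symmetric] sum.distrib)
  also have "\<dots> \<le> \<eta> powr (2 - p) * 2"
    using sums by (intro mult_left_mono) auto
  finally show ?thesis by simp
qed

lemma profile_product_bounds:
  assumes A: "profile p A" and B: "profile p B" and p: "1 \<le> p" "p < 2"
    and small: "\<And>z. z \<in> S \<Longrightarrow> A z \<le> \<eta>"
  shows "(\<lambda>z. A z * B z) summable_on S" and "(\<Sum>\<^sub>\<infinity>z\<in>S. A z * B z) \<le> 2 * \<eta> powr (2 - p)"
    and "0 \<le> (\<Sum>\<^sub>\<infinity>z\<in>S. A z * B z)"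
proof -
  have pos: "0 \<le> A z * B z" for z
    by (simp add: profile_nonneg[OF A] profile_nonneg[OF B])
  have bound: "(\<Sum>z\<in>F. A z * B z) \<le> 2 * \<eta> powr (2 - p)" if "finite F" "F \<subseteq> S" for F
    using that by (intro sum_mult_small_le p profile_nonneg[OF A] profile_nonneg[OF B]
        profile_sum_le[OF A] profile_sum_le[OF B] small) auto
  show *: "(\<lambda>z. A z * B z) summable_on S"
    by (rule nonneg_bdd_above_summable_on)
       (use pos bound in \<open>auto intro!: bdd_aboveI[of _ "2 * \<eta> powr (2 - p)"]\<close>)
  show "(\<Sum>\<^sub>\<infinity>z\<in>S. A z * B z) \<le> 2 * \<eta> powr (2 - p)"
    by (rule infsum_le_finite_sums[OF * bound])
  show "0 \<le> (\<Sum>\<^sub>\<infinity>z\<in>S. A z * B z)" by (rule infsum_nonneg) (rule pos)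
qed

lemma profile_product_summable:
  assumes "profile p A" "profile p B" "1 \<le> p" "p < 2"
  shows "(\<lambda>z. A z * B z) summable_on S"
  by (rule profile_product_bounds(1)[OF assms, of _ 1])
     (use profile_le_1[OF assms(1)] assms(3) in auto)

lemma profile_limit_pointwise:
  fixes u :: "nat \<Rightarrow> 'z \<Rightarrow> real"
  assumes u: "\<And>n. profile p (u n)" and p: "0 < p" and lim: "\<And>k. (\<lambda>n. u n k) \<longlonglongrightarrow> a k"
  shows "profile p a"
  unfolding profile_def
proof (intro conjI allI impI)
  show pos: "0 \<le> a k" for k
    by (rule tendsto_lowerbound[OF lim]) (auto simp: profile_nonneg[OF u])
  fix F :: "'z set" assume F: "finite F"
  have "(\<lambda>n. \<Sum>k\<in>F. u n k powr p) \<longlonglongrightarrow> (\<Sum>k\<in>F. a k powr p)"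
    using p profile_nonneg[OF u] by (intro tendsto_sum tendsto_powr' lim tendsto_const) auto
  then show "(\<Sum>k\<in>F. a k powr p) \<le> 1"
    by (rule tendsto_upperbound) (auto simp: profile_sum_le[OF u F])
qed

text \<open>The decay of \<open>\<eta>\<close> may be too slow for a summable majorant of the products: the intended case is
  \<open>(1 / (k + 1)) powr (1 / p)\<close>. Instead the tails are uniformly small because \<open>u n k\<close> is small there.\<close>

lemma infsum_products_tendsto:
  fixes u w :: "nat \<Rightarrow> nat \<Rightarrow> real"
  assumes p: "1 \<le> p" "p < 2" and u: "\<And>n. profile p (u n)" and w: "\<And>n. profile p (w n)"
    and \<eta>: "\<And>n k. u n k \<le> \<eta> k" "antimono \<eta>" "\<eta> \<longlonglongrightarrow> 0"
    and lim: "\<And>k. (\<lambda>n. u n k) \<longlonglongrightarrow> a k" "\<And>k. (\<lambda>n. w n k) \<longlonglongrightarrow> b k"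
  shows "(\<lambda>n. \<Sum>\<^sub>\<infinity>k. u n k * w n k) \<longlonglongrightarrow> (\<Sum>\<^sub>\<infinity>k. a k * b k)"
proof (rule LIMSEQ_I)
  fix e :: real assume e: "0 < e"
  have \<eta>0: "0 \<le> \<eta> k" for k using \<eta>(1)[of 0 k] profile_nonneg[OF u] order_trans by blast
  have "(\<lambda>k. 2 * \<eta> k powr (2 - p)) \<longlonglongrightarrow> 2 * 0 powr (2 - p)"
    using p \<eta>0 by (intro tendsto_intros tendsto_powr' \<eta>(3)) auto
  then have "\<forall>\<^sub>F k in sequentially. 2 * \<eta> k powr (2 - p) < e / 3"
    by (rule order_tendstoD(2)) (use e p in simp)
  then obtain K where K: "2 * \<eta> K powr (2 - p) < e / 3"
    by (auto simp: eventually_sequentially)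
  have head: "\<bar>(\<Sum>\<^sub>\<infinity>k. x k * y k) - (\<Sum>k<K. x k * y k)\<bar> < e / 3"
    if x: "profile p x" "\<And>k. x k \<le> \<eta> k" and y: "profile p y" for x y
  proof -
    have small: "x k \<le> \<eta> K" if "k \<in> {K..}" for k
      using x(2)[of k] antimonoD[OF \<eta>(2), of K k] that by auto
    have "(UNIV :: nat set) = {..<K} \<union> {K..}" by auto
    then have "(\<Sum>\<^sub>\<infinity>k. x k * y k) = (\<Sum>\<^sub>\<infinity>k\<in>{..<K} \<union> {K..}. x k * y k)" by simp
    also have "\<dots> = (\<Sum>\<^sub>\<infinity>k\<in>{..<K}. x k * y k) + (\<Sum>\<^sub>\<infinity>k\<in>{K..}. x k * y k)"
      by (intro infsum_Un_disjoint profile_product_summable[OF x(1) y p]) auto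
    finally show ?thesis
      using profile_product_bounds(2,3)[where S = "{K..}", OF x(1) y p small] K by simp
  qed
  have a: "profile p a" and b: "profile p b"
    using profile_limit_pointwise u w lim p by (metis less_le_trans zero_less_one)+
  have a\<eta>: "a k \<le> \<eta> k" for k by (rule tendsto_upperbound[OF lim(1)]) (auto simp: \<eta>)
  have "(\<lambda>n. \<Sum>k<K. u n k * w n k) \<longlonglongrightarrow> (\<Sum>k<K. a k * b k)"
    by (intro tendsto_intros lim)
  from LIMSEQ_D[OF this, of "e / 3"] e
  obtain n0 where n0: "\<And>n. n0 \<le> n \<Longrightarrow> \<bar>(\<Sum>k<K. u n k * w n k) - (\<Sum>k<K. a k * b k)\<bar> < e / 3"
    by auto
  show "\<exists>n0. \<forall>n\<ge>n0. norm ((\<Sum>\<^sub>\<infinity>k. u n k * w n k) - (\<Sum>\<^sub>\<infinity>k. a k * b k)) < e"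
  proof (intro exI allI impI)
    fix n assume "n0 \<le> n"
    from n0[OF this] head[OF u[of n] \<eta>(1) w[of n]] head[OF a a\<eta> b]
    show "norm ((\<Sum>\<^sub>\<infinity>k. u n k * w n k) - (\<Sum>\<^sub>\<infinity>k. a k * b k)) < e"
      unfolding real_norm_def by linarith
  qed
qed

definition autocorr :: "('g::group_add \<Rightarrow> real) \<Rightarrow> 'g \<Rightarrow> real" where
  "autocorr f s = (\<Sum>\<^sub>\<infinity>x. f x * f (x + s))"

text \<open>The sum of the autocorrelations of the functions \<open>A (i, _)\<close>. Using one function on a product keeps
  a collection with multiplicities and its \<open>p\<close>-mass in a single object.\<close>

definition family_autocorr :: "('i \<times> 'g::group_add \<Rightarrow> real) \<Rightarrow> 'g \<Rightarrow> real" where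
  "family_autocorr A s = (\<Sum>\<^sub>\<infinity>z. A z * A (fst z, snd z + s))"

lemma inj_right_translate: "inj (\<lambda>z :: 'i \<times> 'g::group_add. (fst z, snd z + s))"
  by (auto simp: inj_def prod_eq_iff)

section \<open>Compactness of autocorrelations\<close>

lemma profile_finite_level:
  assumes A: "profile p A" and e: "0 < e" and p: "0 < p"
  shows "finite {x. e \<le> A x}"
proof (rule ccontr)
  assume inf: "infinite {x. e \<le> A x}"
  obtain n where n: "1 / e powr p < real n" using reals_Archimedean2 by blast
  obtain F where F: "finite F" "card F = n" "F \<subseteq> {x. e \<le> A x}"
    using infinite_arbitrarily_large[OF inf] by blast
  have "real n * e powr p \<le> (\<Sum>x\<in>F. A x powr p)"
    using F e p by (intro order_trans[OF _ sum_bounded_below[of F "e powr p"]])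
      (auto intro!: powr_mono2)
  also have "\<dots> \<le> 1" by (rule profile_sum_le[OF A F(1)])
  finally show False using n e by (simp add: field_simps)
qed

text \<open>Pick successively a point where \<open>f\<close> is maximal among the points not yet chosen; it exists because
  only finitely many values exceed a positive level. The first \<open>k + 1\<close> values are at least the last of
  them, so its \<open>p\<close>-th power is at most \<open>1 / (k + 1)\<close>. If the support is finite, the enumeration goes
  on through points where \<open>f\<close> vanishes.\<close>

lemma decreasing_enumeration:
  fixes f :: "'g \<Rightarrow> real"
  assumes f: "profile p f" and p: "0 < p" and inf: "infinite (UNIV :: 'g set)"
  shows "\<exists>t :: nat \<Rightarrow> 'g. inj t \<and> (\<forall>x. f x \<noteq> 0 \<longrightarrow> x \<in> range t) \<and>
    (\<forall>k. f (t k) \<le> (1 / Suc k) powr (1 / p))"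
proof -
  have ex: "\<exists>y. y \<notin> G \<and> (\<forall>x. x \<notin> G \<longrightarrow> f x \<le> f y)" if G: "finite G" for G
  proof (cases "\<exists>y. y \<notin> G \<and> 0 < f y")
    case True
    then obtain y where y: "y \<notin> G" "0 < f y" by blast
    let ?L = "{x. f y \<le> f x} - G"
    have fin: "finite ?L" using profile_finite_level[OF f y(2) p] by simp
    moreover have "y \<in> ?L" using y by simp
    ultimately have "\<exists>z\<in>?L. f z = Max (f ` ?L)"
      by (metis (mono_tags, lifting) Max_in empty_iff finite_imageI image_iff image_is_empty)
    then obtain z where z: "z \<in> ?L" "f z = Max (f ` ?L)" by blast
    have "f x \<le> f z" if "x \<notin> G" for x
    proof (cases "f y \<le> f x")
      case True with that fin show ?thesis unfolding z(2) by (intro Max_ge) auto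
    next
      case False with z(1) show ?thesis by auto
    qed
    with z(1) show ?thesis by blast
  next
    case False
    obtain y where "y \<notin> G" using ex_new_if_finite[OF inf G] by blast
    with False show ?thesis
      using profile_nonneg[OF f] by (metis linorder_not_le order_trans)
  qed
  have "\<exists>t :: nat \<Rightarrow> 'g. \<forall>k. t k \<notin> t ` {..<k} \<and> (\<forall>x. x \<notin> t ` {..<k} \<longrightarrow> f x \<le> f (t k))"
  proof (rule dependent_wellorder_choice)
    fix r and t u :: "nat \<Rightarrow> 'g" and k :: nat assume "\<And>j. j < k \<Longrightarrow> t j = u j"
    then have "t ` {..<k} = u ` {..<k}" by auto
    then show "(r \<notin> t ` {..<k} \<and> (\<forall>x. x \<notin> t ` {..<k} \<longrightarrow> f x \<le> f r))
        = (r \<notin> u ` {..<k} \<and> (\<forall>x. x \<notin> u ` {..<k} \<longrightarrow> f x \<le> f r))" by simp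
  next
    fix k :: nat and t :: "nat \<Rightarrow> 'g"
    show "\<exists>r. r \<notin> t ` {..<k} \<and> (\<forall>x. x \<notin> t ` {..<k} \<longrightarrow> f x \<le> f r)"
      by (rule ex) simp
  qed
  then obtain t :: "nat \<Rightarrow> 'g" where t: "\<And>k. t k \<notin> t ` {..<k}"
      "\<And>k x. x \<notin> t ` {..<k} \<Longrightarrow> f x \<le> f (t k)" by blast
  have ne: "t j \<noteq> t k" if "j < k" for j k using t(1)[of k] that by (metis imageI lessThan_iff)
  then have inj: "inj t" by (metis injI linorder_neqE_nat)
  have dec: "f (t k) \<le> f (t j)" if "j \<le> k" for j k
  proof (rule t(2))
    show "t k \<notin> t ` {..<j}" using that by (auto simp: inj_eq[OF inj])
  qed
  have bound: "f (t k) \<le> (1 / Suc k) powr (1 / p)" for k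
  proof -
    have "real (Suc k) * f (t k) powr p \<le> (\<Sum>j\<in>{..k}. f (t j) powr p)"
      using p dec profile_nonneg[OF f]
      by (intro order_trans[OF _ sum_bounded_below[of "{..k}" "f (t k) powr p"]])
         (auto intro!: powr_mono2)
    also have "\<dots> \<le> 1" by (rule profile_sum_le[OF profile_comp_inj[OF f inj]]) simp
    finally have "f (t k) powr p \<le> 1 / Suc k" by (simp add: field_simps)
    then have "(f (t k) powr p) powr (1 / p) \<le> (1 / Suc k) powr (1 / p)"
      using p by (intro powr_mono2) auto
    then show ?thesis using p profile_nonneg[OF f, of "t k"] by (simp add: powr_powr)
  qed
  have "x \<in> range t" if "f x \<noteq> 0" for x
  proof (rule ccontr)
    assume "x \<notin> range t"
    then have "f x \<le> f (t k)" for k by (intro t(2)) auto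
    then have "range t \<subseteq> {y. f x \<le> f y}" by auto
    moreover have "finite {y. f x \<le> f y}"
      using that profile_nonneg[OF f, of x] by (intro profile_finite_level[OF f _ p]) simp
    ultimately have "finite (range t)" by (rule finite_subset)
    then show False using inj finite_imageD by blast
  qed
  with inj bound show ?thesis by blast
qed

lemma autocorr_enumeration:
  assumes t: "inj t" and supp: "\<And>x. f x \<noteq> 0 \<Longrightarrow> x \<in> range t"
  shows "autocorr f s = (\<Sum>\<^sub>\<infinity>k. f (t k) * f (t k + s))"
proof -
  have "autocorr f s = (\<Sum>\<^sub>\<infinity>x\<in>range t. f x * f (x + s))"
    unfolding autocorr_def using supp by (intro infsum_cong_neutral) auto
  then show ?thesis by (simp add: infsum_reindex[OF t] o_def)
qed

text \<open>The relation \<open>E j k s\<close>, saying that the \<open>k\<close>-th point is eventually the translate by \<open>s\<close> of the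
  \<open>j\<close>-th, partitions the indices into clusters. Each cluster is named by its least index \<open>rep k\<close>, and
  \<open>off k\<close> is the position of the \<open>k\<close>-th point relative to that of its representative. So
  \<open>k \<mapsto> (rep k, off k)\<close> is an injection, and the limiting family \<open>B\<close> carries the limiting values along
  it; in particular it has no more mass than these values.\<close>

lemma autocorr_limit_of_enumerations:
  fixes f :: "nat \<Rightarrow> 'g::group_add \<Rightarrow> real" and t :: "nat \<Rightarrow> nat \<Rightarrow> 'g" and \<eta> :: "nat \<Rightarrow> real"
  assumes p: "1 \<le> p" "p < 2" and f: "\<And>n. profile p (f n)"
    and t: "\<And>n. inj (t n)" and supp: "\<And>n x. f n x \<noteq> 0 \<Longrightarrow> x \<in> range (t n)"
    and \<eta>: "\<And>n k. f n (t n k) \<le> \<eta> k" "antimono \<eta>" "\<eta> \<longlonglongrightarrow> 0"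
    and a: "\<And>k. (\<lambda>n. f n (t n k)) \<longlonglongrightarrow> a k"
    and dich: "\<And>j k s. (\<forall>\<^sub>F n in sequentially. t n j + s = t n k)
      \<or> (\<forall>\<^sub>F n in sequentially. t n j + s \<noteq> t n k)"
  shows "\<exists>B :: nat \<times> 'g \<Rightarrow> real. profile p B \<and> (\<forall>s. (\<lambda>n. autocorr (f n) s) \<longlonglongrightarrow> family_autocorr B s)"
proof -
  define E where "E j k s \<longleftrightarrow> (\<forall>\<^sub>F n in sequentially. t n j + s = t n k)" for j k s
  have E_refl: "E k k 0" for k by (simp add: E_def)
  have E_trans: "E j l (s + u)" if "E j k s" "E k l u" for j k l s u
    using that unfolding E_def by eventually_elim (simp add: add.assoc[symmetric])
  have E_sym: "E k j (- s)" if "E j k s" for j k s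
    using that unfolding E_def by eventually_elim (metis add_diff_cancel add_uminus_conv_diff)
  have E_fun: "s = u" if "E j k s" "E j k u" for j k s u
  proof -
    have "\<forall>\<^sub>F n in sequentially. s = u"
      using that unfolding E_def by eventually_elim (metis add_left_cancel)
    then show ?thesis by simp
  qed
  have E_inj: "k = l" if "E j k s" "E j l s" for j k l s
  proof -
    have "\<forall>\<^sub>F n in sequentially. k = l"
      using that unfolding E_def by eventually_elim (metis t injD)
    then show ?thesis by simp
  qed
  define rep where "rep k = (LEAST j. \<exists>s. E j k s)" for k
  define off where "off k = (SOME s. E (rep k) k s)" for k
  have E_rep: "E (rep k) k (off k)" for k
  proof -
    have "\<exists>s. E (rep k) k s" unfolding rep_def by (rule LeastI) (use E_refl in blast)
    then show ?thesis unfolding off_def by (rule someI_ex)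
  qed
  have rep_eq: "rep k = rep l" if "E k l s" for k l s
  proof -
    have "(\<exists>u. E j k u) \<longleftrightarrow> (\<exists>u. E j l u)" for j using that E_trans E_sym by blast
    then show ?thesis by (simp add: rep_def)
  qed
  define h where "h k = (rep k, off k)" for k
  have h_inj: "inj h"
    by (rule injI) (metis E_rep E_inj h_def prod.inject)
  have h_shift: "h l = (rep k, off k + s) \<longleftrightarrow> E k l s" for k l s
  proof
    assume "h l = (rep k, off k + s)"
    then have "E (rep k) l (off k + s)" using E_rep[of l] by (simp add: h_def)
    from E_trans[OF E_sym[OF E_rep[of k]] this] show "E k l s" by simp
  next
    assume kl: "E k l s"
    from E_trans[OF E_rep this] rep_eq[OF this] E_rep[of l]
    show "h l = (rep k, off k + s)" using E_fun by (auto simp: h_def)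
  qed
  define B where "B z = (if z \<in> range h then a (inv h z) else 0)" for z
  have Bh: "B (h k) = a k" for k by (simp add: B_def inv_f_f[OF h_inj])
  have B0: "B z = 0" if "z \<notin> range h" for z using that by (simp add: B_def)
  have prof_ft: "profile p (\<lambda>k. f n (t n k))" for n by (rule profile_comp_inj[OF f t])
  have prof_a: "profile p a"
    using p by (intro profile_limit_pointwise[OF prof_ft _ a]) simp
  have prof_B: "profile p B"
    unfolding profile_def
  proof (intro conjI allI impI)
    show "0 \<le> B z" for z using profile_nonneg[OF prof_a] by (simp add: B_def)
    fix F :: "(nat \<times> 'g) set" assume F: "finite F"
    have "(\<Sum>z\<in>F. B z powr p) = (\<Sum>z\<in>h ` (h -` F). B z powr p)"
      using F B0 by (intro sum.mono_neutral_right) auto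
    also have "\<dots> = (\<Sum>k\<in>h -` F. a k powr p)"
      by (simp add: sum.reindex[OF inj_on_subset[OF h_inj subset_UNIV]] Bh o_def del: image_vimage_eq)
    also have "\<dots> \<le> 1" by (rule profile_sum_le[OF prof_a finite_vimageI[OF F h_inj]])
    finally show "(\<Sum>z\<in>F. B z powr p) \<le> 1" .
  qed
  \<comment> \<open>The value at a fixed translate of the \<open>k\<close>-th point converges to the corresponding value of \<open>B\<close>:
    either the translate is eventually another enumerated point, or it eventually avoids the first \<open>L\<close>
    enumerated points for every \<open>L\<close>, and then the value is at most \<open>\<eta> L\<close>.\<close>
  have lim: "(\<lambda>n. f n (t n k + s)) \<longlonglongrightarrow> B (rep k, off k + s)" for k s
  proof (cases "\<exists>l. E k l s")
    case True
    then obtain l where l: "E k l s" by blast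
    have "\<forall>\<^sub>F n in sequentially. f n (t n l) = f n (t n k + s)"
      using l unfolding E_def by eventually_elim simp
    moreover have "B (rep k, off k + s) = a l" using l Bh by (metis h_shift)
    ultimately show ?thesis using a[of l] by (simp add: tendsto_cong)
  next
    case False
    then have "(rep k, off k + s) \<notin> range h" by (metis h_shift imageE)
    then have "B (rep k, off k + s) = 0" by (rule B0)
    moreover have "(\<lambda>n. f n (t n k + s)) \<longlonglongrightarrow> 0"
    proof (rule order_tendstoI)
      show "\<forall>\<^sub>F n in sequentially. c < f n (t n k + s)" if "c < 0" for c
        by (intro always_eventually allI less_le_trans[OF that profile_nonneg[OF f]])
      fix c :: real assume c: "0 < c"
      obtain L where L: "\<eta> L < c"
        using order_tendstoD(2)[OF \<eta>(3) c] by (auto simp: eventually_sequentially)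
      have "\<forall>\<^sub>F n in sequentially. \<forall>l\<in>{..<L}. t n k + s \<noteq> t n l"
        using False dich by (intro eventually_ball_finite) (auto simp: E_def)
      then show "\<forall>\<^sub>F n in sequentially. f n (t n k + s) < c"
      proof eventually_elim
        case (elim n)
        show ?case
        proof (cases "f n (t n k + s) = 0")
          case True with c show ?thesis by simp
        next
          case False
          then obtain l where l: "t n k + s = t n l" using supp by blast
          with elim have "L \<le> l" by (metis lessThan_iff linorder_not_less)
          then have "f n (t n k + s) \<le> \<eta> L"
            using \<eta>(1)[of n l] antimonoD[OF \<eta>(2)] l by (metis order_trans)
          with L show ?thesis by simp
        qed
      qed
    qed
    ultimately show ?thesis by simp
  qed
  have "(\<lambda>n. autocorr (f n) s) \<longlonglongrightarrow> family_autocorr B s" for s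
  proof -
    have inj: "inj (\<lambda>k. t n k + s)" for n using t[of n] by (auto simp: inj_def)
    have "(\<lambda>n. \<Sum>\<^sub>\<infinity>k. f n (t n k) * f n (t n k + s)) \<longlonglongrightarrow> (\<Sum>\<^sub>\<infinity>k. a k * B (rep k, off k + s))"
      by (rule infsum_products_tendsto[OF p prof_ft profile_comp_inj[OF f inj] \<eta> a lim])
    moreover have "family_autocorr B s = (\<Sum>\<^sub>\<infinity>k. a k * B (rep k, off k + s))"
    proof -
      have "family_autocorr B s = (\<Sum>\<^sub>\<infinity>z\<in>range h. B z * B (fst z, snd z + s))"
        unfolding family_autocorr_def using B0 by (intro infsum_cong_neutral) auto
      also have "\<dots> = (\<Sum>\<^sub>\<infinity>k. B (h k) * B (fst (h k), snd (h k) + s))"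
        by (simp add: infsum_reindex[OF h_inj] o_def)
      finally show ?thesis unfolding Bh by (simp add: h_def)
    qed
    ultimately show ?thesis by (simp add: autocorr_enumeration[OF t supp])
  qed
  with prof_B show ?thesis by blast
qed

lemma autocorr_sequentially_compact:
  fixes f :: "nat \<Rightarrow> 'g::group_add \<Rightarrow> real"
  assumes p: "1 \<le> p" "p < 2" and f: "\<And>n. profile p (f n)"
    and cnt: "countable (UNIV :: 'g set)" and inf: "infinite (UNIV :: 'g set)"
  shows "\<exists>r B. strict_mono r \<and> profile p (B :: nat \<times> 'g \<Rightarrow> real) \<and>
    (\<forall>s. (\<lambda>n. autocorr (f (r n)) s) \<longlonglongrightarrow> family_autocorr B s)"
proof -
  define \<eta> where "\<eta> k = (1 / real (Suc k)) powr (1 / p)" for k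
  have "\<forall>n. \<exists>t :: nat \<Rightarrow> 'g. inj t \<and> (\<forall>x. f n x \<noteq> 0 \<longrightarrow> x \<in> range t) \<and> (\<forall>k. f n (t k) \<le> \<eta> k)"
    unfolding \<eta>_def using p by (intro allI decreasing_enumeration[OF f _ inf]) simp
  then obtain t :: "nat \<Rightarrow> nat \<Rightarrow> 'g" where t: "\<And>n. inj (t n)"
      "\<And>n x. f n x \<noteq> 0 \<Longrightarrow> x \<in> range (t n)" "\<And>n k. f n (t n k) \<le> \<eta> k"
    by metis
  \<comment> \<open>One bounded function of a countable index set records both the values and the coincidences of
    translated points, so that a single diagonal argument handles them all.\<close>
  define W where "W n i = (case i of Inl k \<Rightarrow> f n (t n k)
    | Inr (j, k, s) \<Rightarrow> if t n j + s = t n k then 1 else 0)" for n and i :: "nat + nat \<times> nat \<times> 'g"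
  have "norm (W n i) \<le> 1" for n i
    using profile_nonneg[OF f] profile_le_1[OF f] p by (auto simp: W_def split: sum.split)
  moreover have "countable (UNIV :: (nat + nat \<times> nat \<times> 'g) set)"
    unfolding UNIV_Plus_UNIV[symmetric] UNIV_Times_UNIV[symmetric]
    by (intro countable_Plus countable_SIGMA cnt) auto
  ultimately obtain r where r: "strict_mono (r :: nat \<Rightarrow> nat)"
      "\<And>i. \<exists>l. (\<lambda>n. W (r n) i) \<longlonglongrightarrow> l"
    using function_convergent_subsequence[of UNIV W 1] by (metis UNIV_I)
  obtain a where a: "\<And>k. (\<lambda>n. f (r n) (t (r n) k)) \<longlonglongrightarrow> a k"
    using r(2)[of "Inl _"] by (simp add: W_def) metis
  have dich: "(\<forall>\<^sub>F n in sequentially. t (r n) j + s = t (r n) k)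
      \<or> (\<forall>\<^sub>F n in sequentially. t (r n) j + s \<noteq> t (r n) k)" for j k s
  proof -
    obtain l where l: "(\<lambda>n. W (r n) (Inr (j, k, s))) \<longlonglongrightarrow> l" using r(2) by blast
    show ?thesis
    proof (cases "0 < l")
      case True
      from order_tendstoD(1)[OF l this] have "\<forall>\<^sub>F n in sequentially. t (r n) j + s = t (r n) k"
        by eventually_elim (simp add: W_def split: if_splits)
      then show ?thesis ..
    next
      case False
      then have "l < 1" by simp
      from order_tendstoD(2)[OF l this] have "\<forall>\<^sub>F n in sequentially. t (r n) j + s \<noteq> t (r n) k"
        by eventually_elim (simp add: W_def split: if_splits)
      then show ?thesis ..
    qed
  qed
  have "antimono \<eta>"
    unfolding \<eta>_def using p by (intro antimonoI powr_mono2 divide_left_mono) auto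
  moreover have "\<eta> \<longlonglongrightarrow> 0" unfolding \<eta>_def using p by real_asymp
  ultimately have "\<exists>B :: nat \<times> 'g \<Rightarrow> real. profile p B \<and>
      (\<forall>s. (\<lambda>n. autocorr (f (r n)) s) \<longlonglongrightarrow> family_autocorr B s)"
    by (intro autocorr_limit_of_enumerations[OF p f t(1,2,3) _ _ a dich])
  with r(1) show ?thesis by blast
qed

section \<open>Approximating a family by a single function\<close>

lemma separated_translates:
  fixes D :: "'g::group_add set"
  assumes inf: "infinite (UNIV :: 'g set)" and D: "finite D"
  obtains g :: "nat \<Rightarrow> 'g" where "\<And>i j d. i < j \<Longrightarrow> d \<in> D \<Longrightarrow> g j \<noteq> g i + d"
proof -
  have "\<exists>g :: nat \<Rightarrow> 'g. \<forall>j. g j \<notin> (\<lambda>(i, d). g i + d) ` ({..<j} \<times> D)"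
  proof (rule dependent_wellorder_choice)
    fix r and g h :: "nat \<Rightarrow> 'g" and j :: nat assume "\<And>i. i < j \<Longrightarrow> g i = h i"
    then have "(\<lambda>(i, d). g i + d) ` ({..<j} \<times> D) = (\<lambda>(i, d). h i + d) ` ({..<j} \<times> D)"
      by (intro image_cong) auto
    then show "(r \<notin> (\<lambda>(i, d). g i + d) ` ({..<j} \<times> D))
        = (r \<notin> (\<lambda>(i, d). h i + d) ` ({..<j} \<times> D))" by simp
  next
    fix j :: nat and g :: "nat \<Rightarrow> 'g"
    show "\<exists>r. r \<notin> (\<lambda>(i, d). g i + d) ` ({..<j} \<times> D)"
      using D by (intro ex_new_if_finite[OF inf]) auto
  qed
  then obtain g :: "nat \<Rightarrow> 'g" where g: "\<And>j. g j \<notin> (\<lambda>(i, d). g i + d) ` ({..<j} \<times> D)" by blast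
  show ?thesis
  proof (rule that[of g])
    fix i j :: nat and d assume "i < j" "d \<in> D"
    then show "g j \<noteq> g i + d" using g[of j] by (auto simp: image_iff)
  qed
qed

text \<open>Truncate \<open>A\<close> to a finite set \<open>Z\<close> and transport it to the group by \<open>h (i, x) = g i + x\<close>, with
  positions \<open>g i\<close> so far apart that a displacement in \<open>F\<close> between two transported points arises only
  within one member of the family. The mass missing to reach one is placed as a small constant \<open>c\<close> on
  many points \<open>W\<close>. Terms involving \<open>W\<close>, in either factor, contribute at most \<open>4 * c powr (2 - p)\<close>,
  so that the position of \<open>W\<close> does not matter.\<close>

lemma family_autocorr_approx:
  fixes A :: "nat \<times> 'g::group_add \<Rightarrow> real"
  assumes A: "profile p A" and p: "1 \<le> p" "p < 2" and inf: "infinite (UNIV :: 'g set)"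
    and F: "finite F" and e: "0 < e"
  shows "\<exists>f. profile p f \<and> ((\<lambda>x. f x powr p) has_sum 1) UNIV \<and> (\<forall>s\<in>F. \<bar>autocorr f s - family_autocorr A s\<bar> < e)"
proof -
  define \<sigma> where "\<sigma> z s = (fst z, snd z + s)" for z :: "nat \<times> 'g" and s
  have A\<sigma>: "profile p (\<lambda>z. A (\<sigma> z s))" for s
    unfolding \<sigma>_def by (rule profile_comp_inj[OF A inj_right_translate])
  have summ: "(\<lambda>z. A z * A (\<sigma> z s)) summable_on UNIV" for s
    by (rule profile_product_summable[OF A A\<sigma> p])
  have A0: "0 \<le> A z" for z by (rule profile_nonneg[OF A])
  have ev: "\<forall>\<^sub>F Z in finite_subsets_at_top UNIV. \<forall>s\<in>F. family_autocorr A s - e / 2 < (\<Sum>z\<in>Z. A z * A (\<sigma> z s))"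
  proof (intro eventually_ball_finite F ballI)
    fix s
    have "((\<lambda>Z. \<Sum>z\<in>Z. A z * A (\<sigma> z s)) \<longlongrightarrow> family_autocorr A s) (finite_subsets_at_top UNIV)"
      using infsum_tendsto[OF summ[of s]] by (simp add: family_autocorr_def \<sigma>_def)
    then show "\<forall>\<^sub>F Z in finite_subsets_at_top UNIV. family_autocorr A s - e / 2 < (\<Sum>z\<in>Z. A z * A (\<sigma> z s))"
      using e by (intro order_tendstoD) auto
  qed
  have fin: "\<forall>\<^sub>F Z in finite_subsets_at_top (UNIV :: (nat \<times> 'g) set). finite Z"
    by (rule eventually_finite_subsets_at_top_weakI)
  from eventually_happens'[OF finite_subsets_at_top_neq_bot eventually_conj[OF fin ev]]
  obtain Z0 where Z0: "finite Z0"
      "\<And>s. s \<in> F \<Longrightarrow> family_autocorr A s - e / 2 < (\<Sum>z\<in>Z0. A z * A (\<sigma> z s))" by blast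
  \<comment> \<open>\<open>Z\<close> also contains the partners \<open>\<sigma> z s\<close> of the points of \<open>Z0\<close>, so that no product from \<open>Z0\<close> is
    lost by the truncation.\<close>
  define Z where "Z = Z0 \<union> (\<lambda>(z, s). \<sigma> z s) ` (Z0 \<times> F)"
  have Z: "finite Z" "Z0 \<subseteq> Z" using Z0(1) F by (simp_all add: Z_def)
  have Z\<sigma>: "\<sigma> z s \<in> Z" if "z \<in> Z0" "s \<in> F" for z s
    unfolding Z_def by (rule UnI2, rule image_eqI[of _ _ "(z, s)"]) (simp_all add: that)
  \<comment> \<open>Adding the displacement \<open>0\<close> makes \<open>h\<close> injective on \<open>Z\<close>.\<close>
  define F0 where "F0 = insert 0 F"
  define H where "H = snd ` Z"
  \<comment> \<open>The two parts of \<open>D\<close> exclude coincidences in which the translated point lies in the earlier,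
    respectively in the later, of the two members.\<close>
  define D where "D = (\<lambda>(x, s, y). x + s - y) ` (H \<times> F0 \<times> H) \<union> (\<lambda>(x, s, y). y - s - x) ` (H \<times> F0 \<times> H)"
  have "finite D" using Z(1) F by (auto simp: D_def H_def F0_def)
  then obtain g :: "nat \<Rightarrow> 'g" where g: "\<And>i j d. i < j \<Longrightarrow> d \<in> D \<Longrightarrow> g j \<noteq> g i + d"
    using separated_translates[OF inf] by metis
  define h where "h z = g (fst z) + snd z" for z
  have h: "z' = \<sigma> z s" if z: "z \<in> Z" "z' \<in> Z" and s: "s \<in> F0" and eq: "h z + s = h z'" for z z' s
  proof -
    obtain i x j y where zz: "z = (i, x)" "z' = (j, y)" by (metis surj_pair)
    have H: "x \<in> H" "y \<in> H" using z unfolding zz H_def by force+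
    have D: "x + s - y \<in> D" "y - s - x \<in> D"
      unfolding D_def using H s by force+
    have eq': "g i + x + s = g j + y" using eq by (simp add: h_def zz)
    have "g j = g i + (x + s - y)"
      using eq' by (metis add.assoc add_diff_eq eq_diff_eq)
    moreover have "g i = g j + (y - s - x)"
      using eq' by (metis add.assoc add_diff_eq eq_diff_eq)
    ultimately have ij: "i = j" using g D by (metis linorder_neqE_nat)
    then have "y = x + s" using eq' by (simp add: add.assoc)
    then show ?thesis by (simp add: zz ij \<sigma>_def)
  qed
  have inj: "inj_on h Z"
  proof (rule inj_onI)
    fix z z' assume "z \<in> Z" "z' \<in> Z" "h z = h z'"
    then have "z' = \<sigma> z 0" by (intro h) (auto simp: F0_def)
    then show "z = z'" by (simp add: \<sigma>_def)
  qed
  have h\<sigma>: "h (\<sigma> z s) = h z + s" for z s by (simp add: h_def \<sigma>_def add.assoc)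
  define m where "m = (\<Sum>z\<in>Z. A z powr p)"
  have m: "0 \<le> m" "m \<le> 1" using profile_sum_le[OF A Z(1)] by (auto simp: m_def sum_nonneg)
  have "(\<lambda>N. 4 * ((1 / real (Suc N)) powr (1 / p)) powr (2 - p)) \<longlonglongrightarrow> 0"
    using p by real_asymp
  then have "\<forall>\<^sub>F N in sequentially. 4 * ((1 / real (Suc N)) powr (1 / p)) powr (2 - p) < e / 2"
    by (rule order_tendstoD(2)) (use e in simp)
  then obtain N' where N': "4 * ((1 / real (Suc N')) powr (1 / p)) powr (2 - p) < e / 2"
    by (auto simp: eventually_sequentially)
  define N where "N = Suc N'"
  define c where "c = ((1 - m) / N) powr (1 / p)"
  have "c powr (2 - p) \<le> ((1 / real N) powr (1 / p)) powr (2 - p)"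
    unfolding c_def using m p by (intro powr_mono2 divide_right_mono) auto
  then have c: "0 \<le> c" "4 * c powr (2 - p) < e / 2" "N * c powr p = 1 - m"
    using N' m p by (auto simp: c_def N_def powr_powr)
  have "infinite (- h ` Z)" using inf Z(1) by (simp add: Compl_eq_Diff_UNIV)
  then obtain W where W: "finite W" "card W = N" "W \<subseteq> - h ` Z"
    using infinite_arbitrarily_large by blast
  define f where "f x = (if x \<in> h ` Z then A (the_inv_into Z h x) else if x \<in> W then c else 0)" for x
  have f_h: "f (h z) = A z" if "z \<in> Z" for z
    using that by (simp add: f_def the_inv_into_f_f[OF inj])
  have f_W: "f w = c" if "w \<in> W" for w using that W(3) by (auto simp: f_def)
  have f0: "f x = 0" if "x \<notin> h ` Z \<union> W" for x using that by (auto simp: f_def)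
  have f_pos: "0 \<le> f x" for x using A0 c(1) by (simp add: f_def)
  have split: "(\<Sum>x\<in>h ` Z \<union> W. q x) = (\<Sum>z\<in>Z. q (h z)) + (\<Sum>w\<in>W. q w)" for q :: "'g \<Rightarrow> real"
    using Z(1) W by (subst sum.union_disjoint) (auto simp: sum.reindex[OF inj])
  have mass: "(\<Sum>x\<in>h ` Z \<union> W. f x powr p) = 1"
    unfolding split using c(3) W(2) by (simp add: f_h f_W m_def)
  have f_sum: "((\<lambda>x. f x powr p) has_sum 1) UNIV"
    by (rule has_sum_finite_neutralI[of "h ` Z \<union> W"]) (use Z(1) W(1) mass f0 in auto)
  have f: "profile p f"
    unfolding profile_def using f_pos finite_sum_le_has_sum[OF f_sum] by auto
  have near: "\<bar>autocorr f s - family_autocorr A s\<bar> < e" if s: "s \<in> F" for s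
  proof -
    \<comment> \<open>The value of \<open>f\<close> at a translated point comes from \<open>Z\<close> or from \<open>W\<close>.\<close>
    let ?A = "\<lambda>z. if \<sigma> z s \<in> Z then A (\<sigma> z s) else 0"
    let ?C = "\<lambda>z. if h z + s \<in> W then c else 0"
    have fs: "profile p (\<lambda>x. f (x + s))" by (rule profile_comp_inj[OF f]) (auto simp: inj_def)
    have shift: "f (h z + s) = ?A z + ?C z" if z: "z \<in> Z" for z
    proof (cases "\<sigma> z s \<in> Z")
      case True
      then have "h z + s \<in> h ` Z" by (metis h\<sigma> image_eqI)
      then have "h z + s \<notin> W" using W(3) by auto
      with True show ?thesis using f_h[OF True] by (simp add: h\<sigma>)
    next
      case False
      then have "h z + s \<notin> h ` Z" using h[OF z _ _ ] s by (auto simp: F0_def)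
      with False show ?thesis by (simp add: f_def)
    qed
    have "autocorr f s = (\<Sum>\<^sub>\<infinity>x\<in>h ` Z \<union> W. f x * f (x + s))"
      unfolding autocorr_def by (rule infsum_cong_neutral) (auto simp: f0)
    also have "\<dots> = (\<Sum>x\<in>h ` Z \<union> W. f x * f (x + s))" using Z(1) W(1) by simp
    also have "\<dots> = (\<Sum>z\<in>Z. A z * ?A z) + (\<Sum>z\<in>Z. ?C z * A z) + (\<Sum>w\<in>W. c * f (w + s))"
      unfolding split by (simp add: f_h f_W shift distrib_left sum.distrib mult.commute)
    finally have eq: "autocorr f s
        = (\<Sum>z\<in>Z. A z * ?A z) + (\<Sum>z\<in>Z. ?C z * A z) + (\<Sum>w\<in>W. c * f (w + s))" .
    have "(\<Sum>z\<in>Z0. A z * A (\<sigma> z s)) = (\<Sum>z\<in>Z0. A z * ?A z)"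
      using Z\<sigma> s by (intro sum.cong) auto
    also have "\<dots> \<le> (\<Sum>z\<in>Z. A z * ?A z)"
      using Z A0 by (intro sum_mono2) auto
    finally have lower: "family_autocorr A s - e / 2 < (\<Sum>z\<in>Z. A z * ?A z)" using Z0(2)[OF s] by linarith
    have "(\<Sum>z\<in>Z. A z * ?A z) \<le> (\<Sum>z\<in>Z. A z * A (\<sigma> z s))"
      using A0 by (intro sum_mono) auto
    also have "\<dots> \<le> family_autocorr A s"
      using finite_sum_le_infsum[OF summ Z(1)] A0 by (simp add: family_autocorr_def \<sigma>_def)
    finally have upper: "(\<Sum>z\<in>Z. A z * ?A z) \<le> family_autocorr A s" .
    have "(\<Sum>z\<in>Z. ?C z * A z) \<le> 2 * c powr (2 - p)"
    proof (rule sum_mult_small_le[OF p])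
      have "(\<Sum>z\<in>Z. ?C z powr p) \<le> (\<Sum>z\<in>Z. f (h z + s) powr p)"
        using c(1) A0 p by (intro sum_mono powr_mono2) (auto simp: shift)
      also have "\<dots> = (\<Sum>x\<in>h ` Z. f (x + s) powr p)" by (simp add: sum.reindex[OF inj])
      also have "\<dots> \<le> 1" using Z(1) by (intro profile_sum_le[OF fs]) auto
      finally show "(\<Sum>z\<in>Z. ?C z powr p) \<le> 1" .
    qed (use c(1) A0 profile_sum_le[OF A Z(1)] in auto)
    moreover have "(\<Sum>w\<in>W. c * f (w + s)) \<le> 2 * c powr (2 - p)"
    proof (rule sum_mult_small_le[OF p])
      show "(\<Sum>w\<in>W. c powr p) \<le> 1" using W(2) c(3) m(1) by simp
    qed (use c(1) f_pos profile_sum_le[OF fs W(1)] in auto)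
    moreover have "0 \<le> (\<Sum>z\<in>Z. ?C z * A z)" "0 \<le> (\<Sum>w\<in>W. c * f (w + s))"
      using c(1) A0 f_pos by (auto intro!: sum_nonneg)
    ultimately show ?thesis using eq lower upper c(2) by linarith
  qed
  show ?thesis using f f_sum near by blast
qed

section \<open>Multipliers with autocorrelation symbols\<close>

lemma infsum_complex_of_real:
  "(\<Sum>\<^sub>\<infinity>z\<in>S. complex_of_real (f z)) = complex_of_real (\<Sum>\<^sub>\<infinity>z\<in>S. f z)"
  by (intro infsum_bounded_linear_strong bounded_linear_of_real
      summable_on_bounded_linear_iff[OF bounded_linear_of_real bounded_linear_Re]) simp

lemma profile_product_has_sum:
  assumes "profile p A" "profile p B" "1 \<le> p" "p < 2"
  shows "((\<lambda>z. A z * B z) has_sum (\<Sum>\<^sub>\<infinity>z\<in>S. A z * B z)) S"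
  using profile_product_summable[OF assms] by simp

text \<open>With \<open>v (i, t) x = A (i, t - x)\<close> the substitution \<open>t \<mapsto> t + x\<close> turns the Gram kernel
  \<open>\<Sum>\<^sub>u v u x * v u y\<close> into the autocorrelation at \<open>x - y\<close>.\<close>

lemma bounded_schur_family_autocorr:
  fixes A :: "'i \<times> 'g::group_add \<Rightarrow> real"
  assumes C: "0 \<le> C" and sq: "\<And>F. finite F \<Longrightarrow> (\<Sum>z\<in>F. (A z)\<^sup>2) \<le> C"
  shows "bounded_schur C (\<lambda>s. complex_of_real (family_autocorr A s))"
  unfolding bounded_schur_def
proof (intro conjI C ballI)
  fix T :: "'g ell2 \<Rightarrow>\<^sub>L 'g ell2" assume T: "T \<in> bounded_ops"
  define v where "v z x = A (fst z, snd z - x)" for z :: "'i \<times> 'g" and x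
  have v_sq: "(\<Sum>z\<in>U. (v z x)\<^sup>2) \<le> C" if U: "finite U" for U x
  proof -
    have inj: "inj_on (\<lambda>z. (fst z, snd z - x)) U" 
      by (intro inj_onI) (metis diff_add_cancel prod_eqI prod.inject)
    show ?thesis
      using sq[of "(\<lambda>z. (fst z, snd z - x)) ` U"] U by (simp add: sum.reindex[OF inj] v_def)
  qed
  from schur_product_exists[of T C v, OF T C v_sq]
  obtain S where S: "S \<in> bounded_ops" "norm S \<le> C * norm T"
      "\<And>x y. entry S x y = (\<Sum>\<^sub>\<infinity>z. complex_of_real (v z x * v z y)) * entry T x y" by blast
  have "(\<Sum>\<^sub>\<infinity>z. complex_of_real (v z x * v z y)) = complex_of_real (family_autocorr A (x - y))" for x y
  proof -
    have "bij_betw (\<lambda>z :: 'i \<times> 'g. (fst z, snd z + x)) UNIV UNIV"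
      by (rule bij_betw_byWitness[where f' = "\<lambda>z. (fst z, snd z - x)"]) auto
    from infsum_reindex_bij_betw[OF this, of "\<lambda>z. v z x * v z y"]
    have "(\<Sum>\<^sub>\<infinity>z. v z x * v z y) = family_autocorr A (x - y)"
      by (simp add: v_def family_autocorr_def add_diff_eq)
    then show ?thesis unfolding infsum_complex_of_real by simp
  qed
  with S show "\<exists>S\<in>bounded_ops. norm S \<le> C * norm T
      \<and> (\<forall>x y. entry S x y = complex_of_real (family_autocorr A (x - y)) * entry T x y)" by auto
qed

lemma bounded_schur_family_autocorr_profile:
  assumes "profile p A" "1 \<le> p" "p < 2"
  shows "bounded_schur 1 (\<lambda>s. complex_of_real (family_autocorr A s))"
  using profile_sum_squares_le[OF assms] profile_sum_le[OF assms(1)]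
  by (intro bounded_schur_family_autocorr) (auto intro: order_trans)


lemma \<Phi>_of_real: "\<Phi> (\<lambda>x. complex_of_real (g x)) = (\<lambda>s. complex_of_real (autocorr g s))"
  by (rule ext) (simp add: \<Phi>_def autocorr_def infsum_complex_of_real[symmetric])

lemma autocorr_eq_family_autocorr: "autocorr g s = family_autocorr (\<lambda>z :: unit \<times> 'g::group_add. g (snd z)) s"
proof -
  have "bij_betw (snd :: unit \<times> 'g \<Rightarrow> 'g) UNIV UNIV"
    by (rule bij_betw_byWitness[where f' = "\<lambda>x. ((), x)"]) auto
  from infsum_reindex_bij_betw[OF this, of "\<lambda>x. g x * g (x + s)"]
  show ?thesis by (simp add: autocorr_def family_autocorr_def)
qed

lemma bounded_schur_autocorr:
  fixes g :: "'g::group_add \<Rightarrow> real"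
  assumes "profile p g" "1 \<le> p" "p < 2"
  shows "bounded_schur 1 (\<lambda>s. complex_of_real (autocorr g s))"
proof -
  have "profile p (\<lambda>z :: unit \<times> 'g. g (snd z))"
    by (rule profile_comp_inj[OF assms(1)]) (auto simp: inj_def)
  from bounded_schur_family_autocorr_profile[OF this assms(2,3)] show ?thesis
    by (simp add: autocorr_eq_family_autocorr)
qed

lemma has_sum_finite_rows:
  fixes f :: "'i \<times> 'a \<Rightarrow> real"
  assumes "finite F" and "\<And>i. i \<in> F \<Longrightarrow> ((\<lambda>x. f (i, x)) has_sum s i) UNIV"
  shows "(f has_sum sum s F) (F \<times> UNIV)"
proof -
  have "(f has_sum s i) ({i} \<times> UNIV)" if "i \<in> F" for i
  proof -
    have "bij_betw (Pair i) UNIV ({i} \<times> UNIV)" by (auto simp: bij_betw_def inj_on_def)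
    from has_sum_reindex_bij_betw[OF this] show ?thesis using assms(2)[OF that] by blast
  qed
  then have "(f has_sum sum s F) (\<Union>i\<in>F. {i} \<times> UNIV)"
    by (intro sum_has_sum assms(1)) auto
  moreover have "(\<Union>i\<in>F. {i} \<times> UNIV) = F \<times> (UNIV :: 'a set)" by auto
  ultimately show ?thesis by simp
qed

lemma profile_row: "profile p A \<Longrightarrow> profile p (\<lambda>x. A (i, x))"
  by (rule profile_comp_inj[of p A "Pair i"]) (auto simp: inj_def)

text \<open>After removing finitely many members of the family, what is left of the symbol is the
  autocorrelation of the remaining members, whose multiplier norm is at most their total squared mass.
  This is a tail of a convergent series.\<close>

lemma M_op_rows_has_sum:
  fixes A :: "'i \<times> 'g::group_add \<Rightarrow> real"
  assumes A: "profile p A" and p: "1 \<le> p" "p < 2" and I: "\<And>i x. i \<notin> I \<Longrightarrow> A (i, x) = 0"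
  shows "((\<lambda>i. M_op (\<lambda>s. complex_of_real (autocorr (\<lambda>x. A (i, x)) s)))
    has_sum M_op (\<lambda>s. complex_of_real (family_autocorr A s))) I"
proof -
  have sq_le: "(\<Sum>z\<in>F. (A z)\<^sup>2) \<le> 1" if "finite F" for F
    using profile_sum_squares_le[OF A p that] profile_sum_le[OF A that] by linarith
  have row_sq: "(\<Sum>x\<in>F. (A (i, x))\<^sup>2) \<le> 1" if "finite F" for F i
    using profile_sum_squares_le[OF profile_row[OF A] p that, of i]
      profile_sum_le[OF profile_row[OF A] that, of i] by linarith
  define q where "q i = (\<Sum>\<^sub>\<infinity>x. (A (i, x))\<^sup>2)" for i
  have q: "((\<lambda>x. (A (i, x))\<^sup>2) has_sum q i) UNIV" for i
    using nonneg_summable_bounded(1)[where A = UNIV, OF _ row_sq[where i = i]] by (simp add: q_def)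
  define Q where "Q = (\<Sum>\<^sub>\<infinity>z\<in>I \<times> UNIV. (A z)\<^sup>2)"
  have Q: "((\<lambda>z. (A z)\<^sup>2) has_sum Q) (I \<times> UNIV)"
    using nonneg_summable_bounded(1)[OF _ sq_le, of "I \<times> UNIV"] by (simp add: Q_def)
  have qQ: "(q has_sum Q) I" by (rule has_sum_SigmaD[OF Q]) (use q in auto)
  define R where "R F z = (if fst z \<in> F then 0 else A z)" for F z
  show ?thesis
  proof (rule M_op_has_sum[where r = "\<lambda>F. Q - sum q F"])
    show "bounded_schur 1 (\<lambda>s. complex_of_real (family_autocorr A s))"
      by (rule bounded_schur_family_autocorr_profile[OF A p])
    show "bounded_schur 1 (\<lambda>s. complex_of_real (autocorr (\<lambda>x. A (i, x)) s))" for i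
      by (rule bounded_schur_autocorr[OF profile_row[OF A] p])
    show "((\<lambda>F. Q - sum q F) \<longlongrightarrow> 0) (finite_subsets_at_top I)"
      using tendsto_diff[OF tendsto_const[of Q] qQ[unfolded has_sum_def]] by simp
    fix F assume F: "finite F" "F \<subseteq> I"
    have rest: "((\<lambda>z. (A z)\<^sup>2) has_sum (Q - sum q F)) (I \<times> UNIV - F \<times> UNIV)"
      by (rule has_sum_Diff[OF Q has_sum_finite_rows[OF F(1)]]) (use q F in auto)
    have "bounded_schur (Q - sum q F) (\<lambda>s. complex_of_real (family_autocorr (R F) s))"
    proof (rule bounded_schur_family_autocorr)
      show "0 \<le> Q - sum q F" by (rule has_sum_nonneg[OF rest]) simp
      fix G :: "('i \<times> 'g) set" assume G: "finite G"
      have "(\<Sum>z\<in>G. (R F z)\<^sup>2) = (\<Sum>z\<in>G \<inter> (I \<times> UNIV - F \<times> UNIV). (A z)\<^sup>2)"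
        using G I by (intro sum.mono_neutral_cong_right) (auto simp: R_def)
      also have "\<dots> \<le> Q - sum q F"
        by (rule finite_sum_le_has_sum[OF rest]) (use G in auto)
      finally show "(\<Sum>z\<in>G. (R F z)\<^sup>2) \<le> Q - sum q F" .
    qed
    moreover have "family_autocorr (R F) s = family_autocorr A s - (\<Sum>i\<in>F. autocorr (\<lambda>x. A (i, x)) s)" for s
    proof -
      let ?P = "\<lambda>z. A z * A (fst z, snd z + s)"
      have total: "(?P has_sum family_autocorr A s) UNIV"
        unfolding family_autocorr_def
        by (rule profile_product_has_sum[OF A profile_comp_inj[OF A inj_right_translate] p])
      have "inj (\<lambda>x. x + s)" by (auto simp: inj_def)
      then have row: "((\<lambda>x. ?P (i, x)) has_sum autocorr (\<lambda>x. A (i, x)) s) UNIV" for i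
        unfolding autocorr_def
        using profile_product_has_sum[OF profile_row[OF A, of i]
            profile_comp_inj[OF profile_row[OF A, of i]] p] by simp
      have "(?P has_sum (family_autocorr A s - (\<Sum>i\<in>F. autocorr (\<lambda>x. A (i, x)) s))) (UNIV - F \<times> UNIV)"
        by (rule has_sum_Diff[OF total has_sum_finite_rows[OF F(1) row]]) auto
      moreover have "family_autocorr (R F) s = infsum ?P (UNIV - F \<times> UNIV)"
        unfolding family_autocorr_def by (rule infsum_cong_neutral) (auto simp: R_def)
      ultimately show ?thesis by (simp add: infsumI)
    qed
    ultimately show "bounded_schur (Q - sum q F) (\<lambda>s. complex_of_real (family_autocorr A s)
        - (\<Sum>i\<in>F. complex_of_real (autocorr (\<lambda>x. A (i, x)) s)))" by simp
  qed
qed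

lemma lp_norm_powr:
  assumes "0 < p"
  shows "lp_norm p f powr p = (\<Sum>\<^sub>\<infinity>x. cmod (f x) powr p)"
  using assms by (simp add: lp_norm_def powr_powr infsum_nonneg)

lemma unit_interval_valued:
  assumes "\<forall>x. f x \<in> complex_of_real ` {0..1}"
  shows "f x = complex_of_real (Re (f x))" and "0 \<le> Re (f x)" and "cmod (f x) = Re (f x)"
proof -
  obtain c where "f x = complex_of_real c" "0 \<le> c" using assms by (metis atLeastAtMost_iff imageE)
  then show "f x = complex_of_real (Re (f x))" "0 \<le> Re (f x)" "cmod (f x) = Re (f x)" by auto
qed

lemma S_set_eq:
  assumes p: "1 \<le> p" "p < 2"
  shows "S_set p = {M_op (\<lambda>s. complex_of_real (autocorr g s)) | g :: 'g::group_add \<Rightarrow> real.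
    profile p g \<and> ((\<lambda>x. g x powr p) has_sum 1) UNIV}"
proof (intro equalityI subsetI)
  fix M :: "'g roe \<Rightarrow>\<^sub>L 'g roe" assume "M \<in> S_set p"
  then obtain f :: "'g \<Rightarrow> complex" where f: "M = M_op (\<Phi> f)" "f \<in> lp_sphere p" by (auto simp: S_set_def)
  define g where "g x = Re (f x)" for x
  have val: "\<forall>x. f x \<in> complex_of_real ` {0..1}" and s: "lp_summable p f" and n: "lp_norm p f = 1"
    using f(2) by (auto simp: lp_sphere_def)
  note fg = unit_interval_valued[OF val, folded g_def]
  have "(\<Sum>\<^sub>\<infinity>x. g x powr p) = 1"
    using lp_norm_powr[of p f] n p by (simp add: fg(3))
  then have sum: "((\<lambda>x. g x powr p) has_sum 1) UNIV"
    using s by (simp add: lp_summable_def fg(3) has_sum_iff)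
  then have "profile p g"
    unfolding profile_def using fg(2) finite_sum_le_has_sum[OF sum] by auto
  moreover have "f = (\<lambda>x. complex_of_real (g x))" using fg(1) by (rule ext)
  then have "M = M_op (\<lambda>s. complex_of_real (autocorr g s))" by (simp add: f(1) \<Phi>_of_real)
  ultimately show "M \<in> {M_op (\<lambda>s. complex_of_real (autocorr g s)) | g.
      profile p g \<and> ((\<lambda>x. g x powr p) has_sum 1) UNIV}" using sum by blast
next
  fix M :: "'g roe \<Rightarrow>\<^sub>L 'g roe"
  assume "M \<in> {M_op (\<lambda>s. complex_of_real (autocorr g s)) | g.
    profile p g \<and> ((\<lambda>x. g x powr p) has_sum 1) UNIV}"
  then obtain g :: "'g \<Rightarrow> real" where g: "M = M_op (\<lambda>s. complex_of_real (autocorr g s))" "profile p g"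
      "((\<lambda>x. g x powr p) has_sum 1) UNIV" by blast
  have "(\<lambda>x. complex_of_real (g x)) \<in> lp_sphere p"
    using g(3) profile_nonneg[OF g(2)] profile_le_1[OF g(2)] p
    by (auto simp: lp_sphere_def lp_summable_def lp_norm_def has_sum_iff)
  then show "M \<in> S_set p" unfolding S_set_def g(1) \<Phi>_of_real[symmetric] by blast
qed

lemma M_collection_eq:
  fixes A :: "nat \<times> 'g::group_add \<Rightarrow> real"
  assumes A: "profile p A" and p: "1 \<le> p" "p < 2"
    and dom: "\<And>i x. i \<notin> dom \<xi> \<Longrightarrow> A (i, x) = 0"
    and \<xi>: "\<And>i. i \<in> dom \<xi> \<Longrightarrow> \<xi> i = Some (orbit (\<lambda>x. complex_of_real (A (i, x))))"
  shows "M_collection \<xi> = M_op (\<lambda>s. complex_of_real (family_autocorr A s))"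
proof -
  have "M_collection \<xi> = (\<Sum>\<^sub>\<infinity>i\<in>dom \<xi>. M_op (\<lambda>s. complex_of_real (autocorr (\<lambda>x. A (i, x)) s)))"
    unfolding M_collection_def using \<xi> by (intro infsum_cong) (simp add: \<Phi>_orbit_orbit \<Phi>_of_real)
  also have "\<dots> = M_op (\<lambda>s. complex_of_real (family_autocorr A s))"
    by (rule infsumI[OF M_op_rows_has_sum[OF A p dom]])
  finally show ?thesis .
qed

text \<open>Indices outside the domain of a collection correspond to zero members of a family; conversely a
  zero member is itself an admissible orbit, so a family gives a collection defined for all indices.\<close>

lemma X_set_eq:
  assumes p: "1 \<le> p" "p < 2"
  shows "X_set p = {M_op (\<lambda>s. complex_of_real (family_autocorr A s)) | A :: nat \<times> 'g::group_add \<Rightarrow> real. profile p A}"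
proof (intro equalityI subsetI)
  fix M :: "'g roe \<Rightarrow>\<^sub>L 'g roe" assume "M \<in> X_set p"
  then obtain \<xi> :: "nat \<rightharpoonup> ('g \<Rightarrow> complex) set" and \<alpha> where M: "M = M_collection \<xi>"
    and \<alpha>: "\<And>i. i \<in> dom \<xi> \<Longrightarrow> \<xi> i = Some (orbit (\<alpha> i))" "\<And>i. i \<in> dom \<xi> \<Longrightarrow> \<alpha> i \<in> lp_ball p"
    and mass: "(\<lambda>i. lp_norm p (\<alpha> i) powr p) summable_on dom \<xi>"
      "(\<Sum>\<^sub>\<infinity>i\<in>dom \<xi>. lp_norm p (\<alpha> i) powr p) \<le> 1"
    unfolding X_set_def orbit_collections_def by blast
  define A where "A z = (if fst z \<in> dom \<xi> then Re (\<alpha> (fst z) (snd z)) else 0)" for z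
  have val: "\<forall>x. \<alpha> i x \<in> complex_of_real ` {0..1}" if "i \<in> dom \<xi>" for i
    using \<alpha>(2)[OF that] by (auto simp: lp_ball_def)
  have A_row: "\<alpha> i = (\<lambda>x. complex_of_real (A (i, x)))" if "i \<in> dom \<xi>" for i
    using unit_interval_valued(1)[OF val[OF that]] that by (auto simp: A_def)
  have A_pos: "0 \<le> A z" for z using unit_interval_valued(2)[OF val] by (simp add: A_def)
  have row: "((\<lambda>x. A (i, x) powr p) has_sum (lp_norm p (\<alpha> i) powr p)) UNIV" if "i \<in> dom \<xi>" for i
  proof -
    have "lp_summable p (\<alpha> i)" using \<alpha>(2)[OF that] by (simp add: lp_ball_def)
    then show ?thesis
      using p A_pos by (simp add: lp_norm_powr has_sum_iff lp_summable_def A_row[OF that])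
  qed
  have prof: "profile p A"
    unfolding profile_def
  proof (intro conjI allI impI)
    fix F :: "(nat \<times> 'g) set" assume F: "finite F"
    define J where "J = fst ` F \<inter> dom \<xi>"
    have J: "finite J" "J \<subseteq> dom \<xi>" using F by (auto simp: J_def)
    have "(\<Sum>z\<in>F. A z powr p) = (\<Sum>z\<in>F \<inter> J \<times> UNIV. A z powr p)"
      using F by (intro sum.mono_neutral_right) (auto simp: A_def J_def intro: rev_image_eqI)
    also have "\<dots> \<le> (\<Sum>i\<in>J. lp_norm p (\<alpha> i) powr p)"
      by (rule finite_sum_le_has_sum[OF has_sum_finite_rows[OF J(1) row]]) (use J F in auto)
    also have "\<dots> \<le> (\<Sum>\<^sub>\<infinity>i\<in>dom \<xi>. lp_norm p (\<alpha> i) powr p)"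
      by (rule finite_sum_le_infsum[OF mass(1) J]) simp
    finally show "(\<Sum>z\<in>F. A z powr p) \<le> 1" using mass(2) by linarith
  qed (rule A_pos)
  have "M = M_op (\<lambda>s. complex_of_real (family_autocorr A s))"
    unfolding M
  proof (rule M_collection_eq[OF prof p])
    show "A (i, x) = 0" if "i \<notin> dom \<xi>" for i x using that by (simp add: A_def)
    show "\<xi> i = Some (orbit (\<lambda>x. complex_of_real (A (i, x))))" if "i \<in> dom \<xi>" for i
      unfolding A_row[OF that, symmetric] by (rule \<alpha>(1)[OF that])
  qed
  with prof show "M \<in> {M_op (\<lambda>s. complex_of_real (family_autocorr A s)) | A :: nat \<times> 'g \<Rightarrow> real. profile p A}" by blast
next
  fix M :: "'g roe \<Rightarrow>\<^sub>L 'g roe"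
  assume "M \<in> {M_op (\<lambda>s. complex_of_real (family_autocorr A s)) | A :: nat \<times> 'g \<Rightarrow> real. profile p A}"
  then obtain A :: "nat \<times> 'g \<Rightarrow> real" where
    M: "M = M_op (\<lambda>s. complex_of_real (family_autocorr A s))" and A: "profile p A" by blast
  define \<alpha> where "\<alpha> i x = complex_of_real (A (i, x))" for i x
  define \<xi> where "\<xi> i = Some (orbit (\<alpha> i))" for i
  have dom: "dom \<xi> = UNIV" by (auto simp: \<xi>_def)
  have row: "((\<lambda>x. A (i, x) powr p) has_sum (lp_norm p (\<alpha> i) powr p)) UNIV" for i
  proof -
    have "(\<lambda>x. A (i, x) powr p) summable_on UNIV"
      by (rule nonneg_summable_bounded(1)) (use profile_sum_le[OF profile_row[OF A]] in auto)
    then show ?thesis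
      using p profile_nonneg[OF A] by (simp add: lp_norm_powr has_sum_iff \<alpha>_def)
  qed
  have mass: "(\<Sum>i\<in>J. lp_norm p (\<alpha> i) powr p) \<le> 1" if "finite J" for J
    by (rule has_sum_le_finite_sums[OF has_sum_finite_rows[OF that row]])
       (use profile_sum_le[OF A] in auto)
  have "\<alpha> i \<in> lp_ball p" for i
  proof -
    have "lp_norm p (\<alpha> i) \<le> 1"
    proof (rule ccontr)
      assume "\<not> lp_norm p (\<alpha> i) \<le> 1"
      then have "1 < lp_norm p (\<alpha> i) powr p" using p by (intro gr_one_powr) auto
      with mass[of "{i}"] show False by simp
    qed
    moreover have "lp_summable p (\<alpha> i)"
      using row[of i] profile_nonneg[OF A] by (auto simp: lp_summable_def \<alpha>_def has_sum_iff)
    moreover have "\<alpha> i x \<in> complex_of_real ` {0..1}" for x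
      using profile_nonneg[OF A] profile_le_1[OF A] p by (auto simp: \<alpha>_def)
    ultimately show ?thesis by (simp add: lp_ball_def)
  qed
  then have "\<xi> \<in> orbit_collections p"
    unfolding orbit_collections_def
    by (intro CollectI exI[of _ \<alpha>])
       (use nonneg_summable_bounded[OF _ mass, of UNIV] in \<open>simp add: dom, simp add: \<xi>_def\<close>)
  moreover have "M = M_collection \<xi>"
    unfolding M by (rule M_collection_eq[OF A p, symmetric]) (auto simp: \<xi>_def \<alpha>_def[abs_def])
  ultimately show "M \<in> X_set p" by (auto simp: X_set_def)
qed

section \<open>Sequential compactness and closure of \<open>S\<^sub>p\<close>\<close>

text \<open>Exhaust the countable group by finite sets and approximate the symbol on the \<open>n\<close>-th of them up to
  \<open>1 / (n + 1)\<close>.\<close>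

lemma X_set_subset_closure_S_set:
  assumes cnt: "countable (UNIV :: 'g::group_add set)" and inf: "infinite (UNIV :: 'g set)"
    and p: "1 \<le> p" "p < 2"
  shows "(X_set p :: ('g roe \<Rightarrow>\<^sub>L 'g roe) set) \<subseteq> SOT closure_of S_set p"
proof
  fix M :: "'g roe \<Rightarrow>\<^sub>L 'g roe" assume "M \<in> X_set p"
  then obtain A :: "nat \<times> 'g \<Rightarrow> real" where
    M: "M = M_op (\<lambda>s. complex_of_real (family_autocorr A s))" and A: "profile p A"
    unfolding X_set_eq[OF p] by blast
  let ?c = "from_nat_into (UNIV :: 'g set)"
  have "\<forall>n. \<exists>f. profile p f \<and> ((\<lambda>x. f x powr p) has_sum 1) UNIV
      \<and> (\<forall>s\<in>?c ` {..n}. \<bar>autocorr f s - family_autocorr A s\<bar> < 1 / real (Suc n))"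
    by (intro allI family_autocorr_approx[OF A p inf]) auto
  then obtain f where f: "\<And>n. profile p (f n)" "\<And>n. ((\<lambda>x. f n x powr p) has_sum 1) UNIV"
      "\<And>n s. s \<in> ?c ` {..n} \<Longrightarrow> \<bar>autocorr (f n) s - family_autocorr A s\<bar> < 1 / real (Suc n)"
    by metis
  have lim: "(\<lambda>n. autocorr (f n) s) \<longlonglongrightarrow> family_autocorr A s" for s
  proof -
    obtain k where k: "s = ?c k" using from_nat_into_surj[OF cnt, of s] by auto
    have "\<forall>\<^sub>F n in sequentially. norm (autocorr (f n) s - family_autocorr A s) \<le> 1 / real (Suc n)"
      using eventually_ge_at_top[of k]
    proof eventually_elim
      case (elim n)
      then have "s \<in> ?c ` {..n}" unfolding k by blast
      from f(3)[OF this] show ?case by simp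
    qed
    then have "(\<lambda>n. autocorr (f n) s - family_autocorr A s) \<longlonglongrightarrow> 0"
      by (rule Lim_null_comparison) (rule LIMSEQ_Suc[OF lim_1_over_n])
    then show ?thesis by (rule LIM_zero_cancel)
  qed
  note schur = bounded_schur_autocorr[OF f(1) p] bounded_schur_family_autocorr_profile[OF A p]
  have "limitin SOT (\<lambda>n. M_op (\<lambda>s. complex_of_real (autocorr (f n) s))) M sequentially"
    unfolding M
    by (intro limitin_SOT M_op_bounded_ops[OF schur(1)] M_op_bounded_ops[OF schur(2)]
        M_op_tendsto[OF schur] tendsto_of_real lim)
  moreover have "M_op (\<lambda>s. complex_of_real (autocorr (f n) s)) \<in> S_set p" for n
    unfolding S_set_eq[OF p] using f(1,2) by blast
  ultimately show "M \<in> SOT closure_of S_set p" by (rule limitin_imp_in_closure_of)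
qed

lemma S_set_subsequence_limit:
  fixes \<sigma> :: "nat \<Rightarrow> ('g::group_add roe \<Rightarrow>\<^sub>L 'g roe)"
  assumes cnt: "countable (UNIV :: 'g set)" and inf: "infinite (UNIV :: 'g set)"
    and p: "1 \<le> p" "p < 2" and \<sigma>: "\<And>n. \<sigma> n \<in> S_set p"
  shows "\<exists>(A :: nat \<times> 'g \<Rightarrow> real) r. profile p A \<and> strict_mono r \<and>
    (\<forall>T. (\<lambda>n. blinfun_apply (\<sigma> (r n)) T)
      \<longlonglongrightarrow> blinfun_apply (M_op (\<lambda>s. complex_of_real (family_autocorr A s))) T)"
proof -
  have "\<forall>n. \<exists>g. profile p g \<and> \<sigma> n = M_op (\<lambda>s. complex_of_real (autocorr g s))"
    using \<sigma> unfolding S_set_eq[OF p] by blast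
  then obtain g where g: "\<And>n. profile p (g n)"
      "\<And>n. \<sigma> n = M_op (\<lambda>s. complex_of_real (autocorr (g n) s))" by metis
  from autocorr_sequentially_compact[where f = g, OF p g(1) cnt inf]
  obtain r and A :: "nat \<times> 'g \<Rightarrow> real" where r: "strict_mono r" and A: "profile p A"
    and lim: "\<And>s. (\<lambda>n. autocorr (g (r n)) s) \<longlonglongrightarrow> family_autocorr A s" by blast
  have "(\<lambda>n. blinfun_apply (\<sigma> (r n)) T)
      \<longlonglongrightarrow> blinfun_apply (M_op (\<lambda>s. complex_of_real (family_autocorr A s))) T" for T
    unfolding g(2)
    by (intro M_op_tendsto[OF bounded_schur_autocorr[OF g(1) p] bounded_schur_family_autocorr_profile[OF A p]]
        tendsto_of_real lim)
  with r A show ?thesis by blast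
qed

text \<open>For one operator \<open>T\<close>, a sequence in \<open>S_set p\<close> approximates \<open>M\<close> on \<open>T\<close> and on all translations.
  By compactness \<open>M\<close> agrees on these operators with some element of \<open>X_set p\<close>. That element may
  a priori depend on \<open>T\<close>, but its symbol is determined by the values of \<open>M\<close> on the translations, so it
  is the same for every \<open>T\<close>.\<close>

lemma closure_S_set_subset_X_set:
  assumes cnt: "countable (UNIV :: 'g::group_add set)" and inf: "infinite (UNIV :: 'g set)"
    and p: "1 \<le> p" "p < 2"
  shows "SOT closure_of (S_set p :: ('g roe \<Rightarrow>\<^sub>L 'g roe) set) \<subseteq> X_set p"
proof
  fix M :: "'g roe \<Rightarrow>\<^sub>L 'g roe" assume M: "M \<in> SOT closure_of S_set p"
  obtain L :: "'g \<Rightarrow> 'g roe" where L: "\<And>s x y. entry (op_of_roe (L s)) x y = (if x - y = s then 1 else 0)"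
    using translation_operator by metis
  define \<phi> where "\<phi> s = entry (op_of_roe (blinfun_apply M (L s))) s 0" for s
  have *: "\<exists>A :: nat \<times> 'g \<Rightarrow> real. profile p A \<and> \<phi> = (\<lambda>s. complex_of_real (family_autocorr A s))
      \<and> blinfun_apply M T = blinfun_apply (M_op \<phi>) T" for T
  proof -
    define \<tau> where "\<tau> k = (case k of 0 \<Rightarrow> T | Suc j \<Rightarrow> L (from_nat_into UNIV j))" for k
    obtain N where N: "\<And>n. N n \<in> S_set p"
        "\<And>k. (\<lambda>n. blinfun_apply (N n) (\<tau> k)) \<longlonglongrightarrow> blinfun_apply M (\<tau> k)"
      using SOT_closure_sequence[OF M, of \<tau>] by blast
    obtain A :: "nat \<times> 'g \<Rightarrow> real" and r where A: "profile p A" and r: "strict_mono r"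
      and lim: "\<And>T. (\<lambda>n. blinfun_apply (N (r n)) T)
        \<longlonglongrightarrow> blinfun_apply (M_op (\<lambda>s. complex_of_real (family_autocorr A s))) T"
      using S_set_subsequence_limit[where \<sigma> = N, OF cnt inf p N(1)] by blast
    have eq: "blinfun_apply M (\<tau> k) = blinfun_apply (M_op (\<lambda>s. complex_of_real (family_autocorr A s))) (\<tau> k)" for k
      using LIMSEQ_unique[OF LIMSEQ_subseq_LIMSEQ[OF N(2)[of k] r, unfolded o_def] lim] .
    have "\<phi> s = complex_of_real (family_autocorr A s)" for s
    proof -
      obtain k where "from_nat_into (UNIV :: 'g set) k = s" using from_nat_into_surj[OF cnt, of s] by auto
      then have "\<tau> (Suc k) = L s" by (simp add: \<tau>_def)
      then show ?thesis
        using eq[of "Suc k"] entry_M_op[OF bounded_schur_family_autocorr_profile[OF A p], of "L s" s 0]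
        by (simp add: \<phi>_def L)
    qed
    then have "\<phi> = (\<lambda>s. complex_of_real (family_autocorr A s))" by (rule ext)
    with A eq[of 0] show ?thesis by (auto simp: \<tau>_def)
  qed
  then have "M = M_op \<phi>" by (intro blinfun_eqI) blast
  with *[of 0] show "M \<in> X_set p" unfolding X_set_eq[OF p] by blast
qed

theorem corollary1p2:
  fixes p :: real
  assumes "countable (UNIV :: 'g::group_add set)" and "infinite (UNIV :: 'g set)"
    and "1 \<le> p" and "p < 2"
  shows "(S_set p :: ('g roe \<Rightarrow>\<^sub>L 'g roe) set) \<subseteq> bounded_ops \<and>
    relatively_sequentially_compactin SOT (S_set p :: ('g roe \<Rightarrow>\<^sub>L 'g roe) set) \<and>
    SOT closure_of (S_set p :: ('g roe \<Rightarrow>\<^sub>L 'g roe) set) = X_set p"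
proof -
  note p = assms(3,4)
  have bounded: "(S_set p :: ('g roe \<Rightarrow>\<^sub>L 'g roe) set) \<subseteq> bounded_ops"
    unfolding S_set_eq[OF p] using M_op_bounded_ops[OF bounded_schur_autocorr[OF _ p]] by blast
  have "\<exists>l r. strict_mono r \<and> limitin SOT (\<sigma> \<circ> r) l sequentially"
    if \<sigma>: "range \<sigma> \<subseteq> S_set p" for \<sigma> :: "nat \<Rightarrow> ('g roe \<Rightarrow>\<^sub>L 'g roe)"
  proof -
    have \<sigma>': "\<sigma> n \<in> S_set p" for n using \<sigma> by auto
    obtain A :: "nat \<times> 'g \<Rightarrow> real" and r where A: "profile p A" and r: "strict_mono r"
      and lim: "\<And>T. (\<lambda>n. blinfun_apply (\<sigma> (r n)) T)
        \<longlonglongrightarrow> blinfun_apply (M_op (\<lambda>s. complex_of_real (family_autocorr A s))) T"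
      using S_set_subsequence_limit[where \<sigma> = \<sigma>, OF assms \<sigma>'] by blast
    have "limitin SOT (\<sigma> \<circ> r) (M_op (\<lambda>s. complex_of_real (family_autocorr A s))) sequentially"
      using bounded \<sigma>' lim M_op_bounded_ops[OF bounded_schur_family_autocorr_profile[OF A p]]
      by (intro limitin_SOT) auto
    with r show ?thesis by blast
  qed
  then have "relatively_sequentially_compactin SOT (S_set p :: ('g roe \<Rightarrow>\<^sub>L 'g roe) set)"
    unfolding relatively_sequentially_compactin_def topspace_SOT using bounded by blast
  with bounded X_set_subset_closure_S_set[OF assms] closure_S_set_subset_X_set[OF assms] show ?thesis by blast
qed

end
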